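(* Let $T>0$, $\alpha\in(0,1)$, $0\le a<T$, let $O\subset\mathbf{R}^d$ be open, and let $F$ be a real-valued function on $W:=(a,T]\times O\times\mathbf{R}\times\mathbf{R}^d\times\mathbf{S}^d$ with $-\infty<F_*\le F^*<+\infty$ in $W$. A function $u:[0,T]\times O\to\mathbf{R}$ is a viscosity subsolution (resp. supersolution) of $$\partial_t^\alpha u+F(t,x,u,\nabla u,\nabla^2u)=0\quad\text{in }(a,T]\times O$$ if and only if $u^*<+\infty$ (resp. $u_*>-\infty$) in $[0,T]\times O$ and, whenever $((\hat t,\hat x),\varphi)\in((a,T]\times O)\times C^{1,2}((a,T]\times O)$ satisfies $$\max_{(a,T]\times O}(u^*-\varphi)=(u^*-\varphi)(\hat t,\hat x)\quad\Big(\text{resp. }\min_{(a,T]\times O}(u_*-\varphi)=(u_*-\varphi)(\hat t,\hat x)\Big),$$ $K_{(0,\hat t)}[u^*](\hat t,\hat x)$ (resp. $K_{(0,\hat t)}[u_*](\hat t,\hat x)$) exists and $$J[u^*](\hat t,\hat x)+K_{(0,\hat t)}[u^*](\hat t,\hat x)+F_*(\hat t,\hat x,u^*(\hat t,\hat x),\nabla\varphi(\hat t,\hat x),\nabla^2\varphi(\hat t,\hat x))\le0$$ $$\Big(\text{resp. }J[u_*](\hat t,\hat x)+K_{(0,\hat t)}[u_*](\hat t,\hat x)+F^*(\hat t,\hat x,u_*(\hat t,\hat x),\nabla\varphi(\hat t,\hat x),\nabla^2\varphi(\hat t,\hat x))\ge0\Big).$$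
   Context: $\mathbf{S}^d$ is the space of real symmetric $d\times d$ matrices. For $h:A\to\mathbf{R}$ ($A\subset\mathbf{R}^N$), $h^*(x)=\lim_{\sigma\searrow0}\sup\{h(y)\mid y\in A\cap\overline{B(x,\sigma)}\}$ and $h_*=-(-h)^*$ are the upper and lower semicontinuous envelopes ($F_*,F^*$ are taken on $W$). $\partial_t^\alpha$ denotes the Caputo time fractional derivative of order $\alpha$, $(\partial_t^\alpha u)(t,x)=\frac{1}{\Gamma(1-\alpha)}\int_0^t\frac{\partial_tu(s,x)}{(t-s)^\alpha}ds$; viscosity solutions are defined through the following operators. For a function $f$ on $[0,T]$ and $t\in(0,T]$, $$J[f](t)=\frac{f(t)-f(0)}{t^\alpha\Gamma(1-\alpha)},\qquad K_{(b,c)}[f](t)=\frac{\alpha}{\Gamma(1-\alpha)}\int_b^c(f(t)-f(t-\tau))\frac{d\tau}{\tau^{\alpha+1}}\quad(0\le b<c\le t).$$ For semicontinuous $f$ and $b>0$ the integral is a Lebesgue integral; $K_{(0,t)}[f](t)$ means $\lim_{b\searrow0}K_{(b,t)}[f](t)$, and one says that $K_{(0,t)}[f](t)$ exists if $K_{(b,t)}[f^\pm](t)$ are finite for each $b\in(0,t)$ and $\lim_{b\searrow0}K_{(b,t)}[f^\pm](t)$ exist as finite numbers, where $f^\pm=\max\{\pm f,0\}$. For functions of $(t,x)$, $J[u](t,x)=J[u(\cdot,x)](t)$ and $K_{(b,c)}[u](t,x)=K_{(b,c)}[u(\cdot,x)](t)$. $C^{1,2}((a,T]\times O)$ is the space of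 functions $\varphi$ such that $\varphi,\partial_t\varphi,\nabla\varphi,\nabla^2\varphi$ are continuous in $(a,T)\times O$ and in some neighborhood of $\{T\}\times O$. A function $u:[0,T]\times O\to\mathbf{R}$ is a viscosity subsolution of the equation in $(a,T]\times O$ if $u^*<+\infty$ on $[0,T]\times O$ and $$J[\varphi](\hat t,\hat x)+K_{(0,\hat t)}[\varphi](\hat t,\hat x)+F_*(\hat t,\hat x,u^*(\hat t,\hat x),\nabla\varphi(\hat t,\hat x),\nabla^2\varphi(\hat t,\hat x))\le0$$ whenever $(\hat t,\hat x)\in(a,T]\times O$ and $\varphi\in C^{1,2}((a,T]\times O)\cap C([0,T]\times O)$ satisfy $\max_{[0,T]\times O}(u^*-\varphi)=(u^*-\varphi)(\hat t,\hat x)$. It is a viscosity supersolution if $u_*>-\infty$ in $[0,T]\times O$ and $$J[\varphi](\hat t,\hat x)+K_{(0,\hat t)}[\varphi](\hat t,\hat x)+F^*(\hat t,\hat x,u_*(\hat t,\hat x),\nabla\varphi(\hat t,\hat x),\nabla^2\varphi(\hat t,\hat x))\ge0$$ whenever such $(\hat t,\hat x)$, $\varphi$ satisfy $\min_{[0,T]\times O}(u_*-\varphi)=(u_*-\varphi)(\hat t,\hat x)$. *)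

theory Defs
  imports "HOL-Analysis.Analysis"
begin

text \<open>
  A function of time and space is a function on \<open>real \<times> real ^ 'd\<close>. All functions are total;
  only their values on the relevant sets enter the definitions below.
\<close>

definition usc_env :: "'m::metric_space set \<Rightarrow> ('m \<Rightarrow> real) \<Rightarrow> 'm \<Rightarrow> ereal" where
  "usc_env A h x = Lim (at_right 0) (\<lambda>\<sigma>. SUP y\<in>A \<inter> cball x \<sigma>. ereal (h y))"

definition lsc_env :: "'m::metric_space set \<Rightarrow> ('m \<Rightarrow> real) \<Rightarrow> 'm \<Rightarrow> ereal" where
  "lsc_env A h x = - usc_env A (\<lambda>y. - h y) x"

definition domW :: "real \<Rightarrow> real \<Rightarrow> (real ^ 'd) set
    \<Rightarrow> (real \<times> (real ^ 'd) \<times> real \<times> (real ^ 'd) \<times> (real ^ 'd ^ 'd)) set" where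
  "domW a T \<Omega> = {a<..T} \<times> \<Omega> \<times> UNIV \<times> UNIV \<times> {X. transpose X = X}"

definition J :: "real \<Rightarrow> (real \<Rightarrow> real) \<Rightarrow> real \<Rightarrow> real" where
  "J \<alpha> f t = (f t - f 0) / (t powr \<alpha> * Gamma (1 - \<alpha>))"

definition K_integrand :: "real \<Rightarrow> (real \<Rightarrow> real) \<Rightarrow> real \<Rightarrow> real \<Rightarrow> real" where
  "K_integrand \<alpha> f t \<tau> = (f t - f (t - \<tau>)) / \<tau> powr (\<alpha> + 1)"

text \<open>
  \<open>K \<alpha> b c f t\<close> is meant for \<open>0 < b\<close>; for \<open>b = 0\<close> one uses \<open>K0\<close>. The Bochner integral is \<open>0\<close> for
  a non-integrable function and \<open>Lim\<close> is unspecified for a divergent one, so finiteness is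
  expressed separately by \<open>K0_exists\<close>.
\<close>

definition K :: "real \<Rightarrow> real \<Rightarrow> real \<Rightarrow> (real \<Rightarrow> real) \<Rightarrow> real \<Rightarrow> real" where
  "K \<alpha> b c f t = \<alpha> / Gamma (1 - \<alpha>) *
     set_lebesgue_integral lebesgue {b<..<c} (K_integrand \<alpha> f t)"

definition K0 :: "real \<Rightarrow> (real \<Rightarrow> real) \<Rightarrow> real \<Rightarrow> real" where
  "K0 \<alpha> f t = Lim (at_right 0) (\<lambda>b. K \<alpha> b t f t)"

definition K0_part_exists :: "real \<Rightarrow> (real \<Rightarrow> real) \<Rightarrow> real \<Rightarrow> bool" where
  "K0_part_exists \<alpha> g t \<longleftrightarrow>
     (\<forall>b\<in>{0<..<t}. set_integrable lebesgue {b<..<t} (K_integrand \<alpha> g t)) \<and>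
     (\<exists>l. ((\<lambda>b. K \<alpha> b t g t) \<longlongrightarrow> l) (at_right 0))"

definition K0_exists :: "real \<Rightarrow> (real \<Rightarrow> real) \<Rightarrow> real \<Rightarrow> bool" where
  "K0_exists \<alpha> f t \<longleftrightarrow>
     K0_part_exists \<alpha> (\<lambda>s. max (f s) 0) t \<and> K0_part_exists \<alpha> (\<lambda>s. max (- f s) 0) t"

definition dt :: "(real \<times> (real ^ 'd) \<Rightarrow> real) \<Rightarrow> real \<times> (real ^ 'd) \<Rightarrow> real" where
  "dt \<phi> p = deriv (\<lambda>s. \<phi> (s, snd p)) (fst p)"

definition grad :: "(real \<times> (real ^ 'd) \<Rightarrow> real) \<Rightarrow> real \<times> (real ^ 'd) \<Rightarrow> real ^ 'd" where
  "grad \<phi> p = (\<chi> i. frechet_derivative (\<lambda>y. \<phi> (fst p, y)) (at (snd p)) (axis i 1))"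

definition hess :: "(real \<times> (real ^ 'd) \<Rightarrow> real) \<Rightarrow> real \<times> (real ^ 'd) \<Rightarrow> real ^ 'd ^ 'd" where
  "hess \<phi> p = matrix (frechet_derivative (\<lambda>y. grad \<phi> (fst p, y)) (at (snd p)))"

text \<open>
  The regularity class of test functions: the derivatives exist and are continuous on the open set
  \<open>(a,T) \<times> \<Omega>\<close> and on an open neighbourhood \<open>V\<close> of \<open>{T} \<times> \<Omega>\<close>, which may contain times beyond \<open>T\<close>, so
  that derivatives at time \<open>T\<close> are two-sided.
\<close>

definition C12_on :: "(real \<times> (real ^ 'd)) set \<Rightarrow> (real \<times> (real ^ 'd) \<Rightarrow> real) \<Rightarrow> bool" where
  "C12_on S \<phi> \<longleftrightarrow>
     (\<forall>(t, x)\<in>S. (\<lambda>s. \<phi> (s, x)) differentiable (at t) \<and>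
                 (\<lambda>y. \<phi> (t, y)) differentiable (at x) \<and>
                 (\<lambda>y. grad \<phi> (t, y)) differentiable (at x)) \<and>
     continuous_on S \<phi> \<and> continuous_on S (dt \<phi>) \<and>
     continuous_on S (grad \<phi>) \<and> continuous_on S (hess \<phi>)"

definition C12 :: "real \<Rightarrow> real \<Rightarrow> (real ^ 'd) set \<Rightarrow> (real \<times> (real ^ 'd) \<Rightarrow> real) \<Rightarrow> bool" where
  "C12 a T \<Omega> \<phi> \<longleftrightarrow>
     C12_on ({a<..<T} \<times> \<Omega>) \<phi> \<and> (\<exists>V. open V \<and> {T} \<times> \<Omega> \<subseteq> V \<and> C12_on V \<phi>)"

definition max_on_at :: "'m set \<Rightarrow> ('m \<Rightarrow> real) \<Rightarrow> 'm \<Rightarrow> bool" where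
  "max_on_at S g p \<longleftrightarrow> p \<in> S \<and> (\<forall>q\<in>S. g q \<le> g p)"

definition min_on_at :: "'m set \<Rightarrow> ('m \<Rightarrow> real) \<Rightarrow> 'm \<Rightarrow> bool" where
  "min_on_at S g p \<longleftrightarrow> p \<in> S \<and> (\<forall>q\<in>S. g p \<le> g q)"

text \<open>
  Real-valued versions of the envelopes \<open>u\<^sup>*\<close>, \<open>u\<^sub>*\<close> of \<open>u\<close> on \<open>[0,T] \<times> \<Omega>\<close>. They are only used together
  with \<open>u\<^sup>* < \<infinity>\<close> respectively \<open>u\<^sub>* > -\<infinity>\<close>; since \<open>u\<^sub>* \<le> u \<le> u\<^sup>*\<close> and \<open>u\<close> is real-valued, the envelope is
  then finite.
\<close>

definition upper :: "real \<Rightarrow> (real ^ 'd) set \<Rightarrow> (real \<times> (real ^ 'd) \<Rightarrow> real)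
    \<Rightarrow> real \<times> (real ^ 'd) \<Rightarrow> real" where
  "upper T \<Omega> u p = real_of_ereal (usc_env ({0..T} \<times> \<Omega>) u p)"

definition lower :: "real \<Rightarrow> (real ^ 'd) set \<Rightarrow> (real \<times> (real ^ 'd) \<Rightarrow> real)
    \<Rightarrow> real \<times> (real ^ 'd) \<Rightarrow> real" where
  "lower T \<Omega> u p = real_of_ereal (lsc_env ({0..T} \<times> \<Omega>) u p)"

definition viscosity_subsolution ::
  "real \<Rightarrow> real \<Rightarrow> real \<Rightarrow> (real ^ 'd) set
    \<Rightarrow> (real \<times> (real ^ 'd) \<times> real \<times> (real ^ 'd) \<times> (real ^ 'd ^ 'd) \<Rightarrow> real)
    \<Rightarrow> (real \<times> (real ^ 'd) \<Rightarrow> real) \<Rightarrow> bool" where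
  "viscosity_subsolution \<alpha> a T \<Omega> F u \<longleftrightarrow>
     (\<forall>p\<in>{0..T} \<times> \<Omega>. usc_env ({0..T} \<times> \<Omega>) u p < \<infinity>) \<and>
     (\<forall>t x \<phi>. t \<in> {a<..T} \<longrightarrow> x \<in> \<Omega> \<longrightarrow> C12 a T \<Omega> \<phi> \<longrightarrow> continuous_on ({0..T} \<times> \<Omega>) \<phi> \<longrightarrow>
        max_on_at ({0..T} \<times> \<Omega>) (\<lambda>p. upper T \<Omega> u p - \<phi> p) (t, x) \<longrightarrow>
        ereal (J \<alpha> (\<lambda>s. \<phi> (s, x)) t + K0 \<alpha> (\<lambda>s. \<phi> (s, x)) t)
          + lsc_env (domW a T \<Omega>) F (t, x, upper T \<Omega> u (t, x), grad \<phi> (t, x), hess \<phi> (t, x)) \<le> 0)"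

definition viscosity_supersolution ::
  "real \<Rightarrow> real \<Rightarrow> real \<Rightarrow> (real ^ 'd) set
    \<Rightarrow> (real \<times> (real ^ 'd) \<times> real \<times> (real ^ 'd) \<times> (real ^ 'd ^ 'd) \<Rightarrow> real)
    \<Rightarrow> (real \<times> (real ^ 'd) \<Rightarrow> real) \<Rightarrow> bool" where
  "viscosity_supersolution \<alpha> a T \<Omega> F u \<longleftrightarrow>
     (\<forall>p\<in>{0..T} \<times> \<Omega>. lsc_env ({0..T} \<times> \<Omega>) u p > -\<infinity>) \<and>
     (\<forall>t x \<phi>. t \<in> {a<..T} \<longrightarrow> x \<in> \<Omega> \<longrightarrow> C12 a T \<Omega> \<phi> \<longrightarrow> continuous_on ({0..T} \<times> \<Omega>) \<phi> \<longrightarrow>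
        min_on_at ({0..T} \<times> \<Omega>) (\<lambda>p. lower T \<Omega> u p - \<phi> p) (t, x) \<longrightarrow>
        ereal (J \<alpha> (\<lambda>s. \<phi> (s, x)) t + K0 \<alpha> (\<lambda>s. \<phi> (s, x)) t)
          + usc_env (domW a T \<Omega>) F (t, x, lower T \<Omega> u (t, x), grad \<phi> (t, x), hess \<phi> (t, x)) \<ge> 0)"

end

theory Submission
  imports Defs
begin

text \<open>
  If \<open>\<phi>\<close> touches \<open>u\<^sup>*\<close> from above on all of \<open>[0,T] \<times> \<Omega>\<close> at \<open>(t, x)\<close>, the increments at \<open>t\<close> of \<open>\<phi>(\<cdot>, x)\<close> are
  dominated by those of \<open>u\<^sup>*(\<cdot>, x)\<close>, so replacing \<open>u\<^sup>*\<close> by \<open>\<phi>\<close> decreases \<open>J + K\<close>.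
  Conversely, let \<open>\<phi>\<close> touch \<open>u\<^sup>*\<close> on \<open>(a,T] \<times> \<Omega>\<close> only. At times close to \<open>a\<close> one blends \<open>\<phi>\<close> with a \<open>C\<^sup>2\<close>
  function of the space variable dominating \<open>u\<^sup>*\<close>; this gives a test function \<open>\<Phi>\<close> on \<open>[0,T] \<times> \<Omega>\<close>. Let
  \<open>z = u\<^sup>* - \<Phi> - const \<le> 0\<close> with \<open>z(t, x) = 0\<close>, let \<open>h\<^sub>N(s) = sup (z(s',x') - N |s - s'| - N |x - x'|\<^sup>2)\<close>
  be its sup-convolution, and let \<open>P\<^sub>N\<close> be a polynomial with \<open>h\<^sub>N \<le> P\<^sub>N \<le> h\<^sub>N + 1/N\<close>. With a cutoff \<open>\<eta>\<^sub>N\<close>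
  that vanishes for \<open>s \<ge> t - 1/N\<close>, the functions \<open>\<Phi> + \<eta>\<^sub>N (P\<^sub>N(s) + N |y - x|\<^sup>2)\<close> of \<open>(s, y)\<close> are admissible, agree
  with \<open>\<phi>\<close> at time \<open>t\<close>, converge to \<open>u\<^sup>*\<close> (up to the constant) on the line through \<open>x\<close>, and stay below
  \<open>\<Phi> + (t - s)\<close> there. Fatou's lemma then yields both the existence of \<open>K\<^bsub>(0,t)\<^esub>[u\<^sup>*]\<close> and the inequality.
\<close>

section \<open>The class \<open>C\<^sup>1\<^sup>,\<^sup>2\<close>\<close>

text \<open>The derivatives are explicit data, so closure under sums and products follows from the
  rules for \<open>has_derivative\<close>; \<open>deriv\<close> and
  \<open>frechet_derivative\<close> are evaluated only in the translation to
  \<open>C12_on\<close>.\<close>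

definition C12_witness :: "(real \<times> (real ^ 'd)) set \<Rightarrow> (real \<times> (real ^ 'd) \<Rightarrow> real) \<Rightarrow>
    (real \<times> (real ^ 'd) \<Rightarrow> real) \<Rightarrow> (real \<times> (real ^ 'd) \<Rightarrow> real ^ 'd) \<Rightarrow> (real \<times> (real ^ 'd) \<Rightarrow> real ^ 'd ^ 'd) \<Rightarrow> bool" where
  "C12_witness S \<phi> d g H \<longleftrightarrow>
     (\<forall>t x. (t, x) \<in> S \<longrightarrow>
       ((\<lambda>s. \<phi> (s, x)) has_real_derivative d (t, x)) (at t) \<and>
       ((\<lambda>y. \<phi> (t, y)) has_derivative (\<lambda>h. g (t, x) \<bullet> h)) (at x) \<and>
       ((\<lambda>y. g (t, y)) has_derivative (\<lambda>h. H (t, x) *v h)) (at x)) \<and>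
     continuous_on S \<phi> \<and> continuous_on S d \<and> continuous_on S g \<and> continuous_on S H"

lemma grad_eqI:
  assumes "((\<lambda>y. \<phi> (fst p, y)) has_derivative (\<lambda>h. g \<bullet> h)) (at (snd p))"
  shows "grad \<phi> p = g"
  using frechet_derivative_at[OF assms, symmetric]
  by (simp add: grad_def vec_eq_iff inner_axis)

lemma eventually_slice:
  assumes "open S" and "(t, x) \<in> S"
  shows "\<forall>\<^sub>F y in nhds x. (t, y) \<in> S"
proof -
  have "open ((\<lambda>y. (t, y)) -` S)"
    by (rule open_vimage[OF assms(1)]) (intro continuous_intros)
  then show ?thesis
    using assms(2) by (auto simp: eventually_nhds intro!: exI[of _ "(\<lambda>y. (t, y)) -` S"])
qed

lemma has_derivative_transform_nhds:
  assumes "(f has_derivative f') (at x)" and "\<forall>\<^sub>F y in nhds x. f y = g y"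
  shows "(g has_derivative f') (at x)"
proof -
  obtain U where "open U" "x \<in> U" "\<And>y. y \<in> U \<Longrightarrow> f y = g y"
    using assms(2) by (auto simp: eventually_nhds)
  then show ?thesis
    using has_derivative_transform_within_open[OF assms(1)] by blast
qed

text \<open>Openness matters for the Hessian: \<open>hess \<phi>\<close> differentiates
  \<open>grad \<phi>\<close>, which is known to equal \<open>g\<close> only on \<open>S\<close>, so
  a neighbourhood of x within the time slice has to lie in \<open>S\<close> before the derivative of
  \<open>g\<close> can be transferred.\<close>

lemma C12_on_iff_witness:
  assumes S: "open S"
  shows "C12_on S \<phi> \<longleftrightarrow> (\<exists>d g H. C12_witness S \<phi> d g H)"
proof
  assume C: "C12_on S \<phi>"
  have "C12_witness S \<phi> (dt \<phi>) (grad \<phi>) (hess \<phi>)"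
    unfolding C12_witness_def
  proof (intro conjI allI impI)
    fix t x assume tx: "(t, x) \<in> S"
    have diff: "(\<lambda>s. \<phi> (s, x)) differentiable (at t)" "(\<lambda>y. \<phi> (t, y)) differentiable (at x)"
      "(\<lambda>y. grad \<phi> (t, y)) differentiable (at x)"
      using C tx by (auto simp: C12_on_def)
    show "((\<lambda>s. \<phi> (s, x)) has_real_derivative dt \<phi> (t, x)) (at t)"
      using diff(1) by (simp add: dt_def field_differentiable_derivI DERIV_deriv_iff_real_differentiable)
    let ?f = "frechet_derivative (\<lambda>y. \<phi> (t, y)) (at x)"
    have "((\<lambda>y. \<phi> (t, y)) has_derivative ?f) (at x)"
      using diff(2) frechet_derivative_works by blast
    moreover have "?f = (\<lambda>h. grad \<phi> (t, x) \<bullet> h)"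
    proof
      fix h
      interpret linear ?f by (rule linear_frechet_derivative[OF diff(2)])
      have "?f h = ?f (\<Sum>i\<in>UNIV. h $ i *\<^sub>R axis i 1)"
        by (simp add: basis_expansion flip: scalar_mult_eq_scaleR)
      also have "\<dots> = (\<Sum>i\<in>UNIV. h $ i * ?f (axis i 1))"
        by (simp add: sum scale)
      finally show "?f h = grad \<phi> (t, x) \<bullet> h"
        by (simp add: grad_def inner_vec_def mult.commute)
    qed
    ultimately show "((\<lambda>y. \<phi> (t, y)) has_derivative (\<lambda>h. grad \<phi> (t, x) \<bullet> h)) (at x)"
      by simp
    have "((\<lambda>y. grad \<phi> (t, y)) has_derivative frechet_derivative (\<lambda>y. grad \<phi> (t, y)) (at x)) (at x)"
      using diff(3) frechet_derivative_works by blast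
    moreover have "frechet_derivative (\<lambda>y. grad \<phi> (t, y)) (at x) = (\<lambda>h. hess \<phi> (t, x) *v h)"
      using matrix_works[OF linear_frechet_derivative[OF diff(3), folded linear_matrix_vector_mul_eq]]
      by (auto simp: hess_def)
    ultimately show "((\<lambda>y. grad \<phi> (t, y)) has_derivative (\<lambda>h. hess \<phi> (t, x) *v h)) (at x)"
      by simp
  qed (use C in \<open>auto simp: C12_on_def\<close>)
  then show "\<exists>d g H. C12_witness S \<phi> d g H" by blast
next
  assume "\<exists>d g H. C12_witness S \<phi> d g H"
  then obtain d g H where W: "C12_witness S \<phi> d g H" by blast
  have D: "((\<lambda>s. \<phi> (s, x)) has_real_derivative d (t, x)) (at t)"
    "((\<lambda>y. \<phi> (t, y)) has_derivative (\<lambda>h. g (t, x) \<bullet> h)) (at x)"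
    "((\<lambda>y. g (t, y)) has_derivative (\<lambda>h. H (t, x) *v h)) (at x)" if "(t, x) \<in> S" for t x
    using W that by (auto simp: C12_witness_def)
  have dt: "dt \<phi> p = d p" if "p \<in> S" for p
    using D(1)[of "fst p" "snd p"] that by (auto simp: dt_def intro: DERIV_imp_deriv)
  have grad: "grad \<phi> p = g p" if "p \<in> S" for p
    using D(2)[of "fst p" "snd p"] that by (auto intro: grad_eqI)
  have gradD: "((\<lambda>y. grad \<phi> (t, y)) has_derivative (\<lambda>h. H (t, x) *v h)) (at x)" if "(t, x) \<in> S" for t x
  proof (rule has_derivative_transform_nhds[OF D(3)[OF that]])
    show "\<forall>\<^sub>F y in nhds x. g (t, y) = grad \<phi> (t, y)"
      using eventually_slice[OF S that] by eventually_elim (simp add: grad)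
  qed
  have hess: "hess \<phi> p = H p" if "p \<in> S" for p
    using frechet_derivative_at[OF gradD[of "fst p" "snd p"], symmetric] that
    by (simp add: hess_def matrix_of_matrix_vector_mul)
  have "continuous_on S (dt \<phi>)" "continuous_on S (grad \<phi>)" "continuous_on S (hess \<phi>)"
    using W by (auto simp: C12_witness_def dt grad hess cong: continuous_on_cong)
  moreover have "(\<lambda>s. \<phi> (s, x)) differentiable (at t)" "(\<lambda>y. \<phi> (t, y)) differentiable (at x)"
    "(\<lambda>y. grad \<phi> (t, y)) differentiable (at x)" if "(t, x) \<in> S" for t x
    using D(1,2)[OF that] gradD[OF that]
    by (auto simp: has_field_derivative_def differentiable_def)
  ultimately show "C12_on S \<phi>"
    using W by (auto simp: C12_on_def C12_witness_def)
qed

lemma C12_witness_add: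
  assumes "C12_witness S \<phi> d g H" and "C12_witness S \<psi> d' g' H'"
  shows "C12_witness S (\<lambda>p. \<phi> p + \<psi> p) (\<lambda>p. d p + d' p) (\<lambda>p. g p + g' p) (\<lambda>p. H p + H' p)"
  using assms unfolding C12_witness_def
  by (auto intro!: DERIV_add has_derivative_eq_rhs[OF has_derivative_add] continuous_on_add
      simp: inner_add_left matrix_vector_mult_add_rdistrib)

text \<open>All cutoffs of the proof act on time alone, so they merely rescale gradient and Hessian
  and create no mixed terms. Constant factors give negation and scaling.\<close>

lemma C12_witness_time_mult:
  assumes W: "C12_witness S \<phi> d g H" and c: "\<And>t. (c has_real_derivative c' t) (at t)" and c': "continuous_on UNIV c'"
  shows "C12_witness S (\<lambda>p. c (fst p) * \<phi> p) (\<lambda>p. c' (fst p) * \<phi> p + c (fst p) * d p)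
    (\<lambda>p. c (fst p) *\<^sub>R g p) (\<lambda>p. c (fst p) *\<^sub>R H p)"
proof -
  have "continuous_on UNIV c"
    using c by (meson DERIV_continuous_on has_field_derivative_at_within)
  then have cont: "continuous_on S (\<lambda>p. c (fst p))" "continuous_on S (\<lambda>p. c' (fst p))"
    using c' by (auto intro!: continuous_on_compose2[of UNIV _ S fst] continuous_intros)
  show ?thesis
    unfolding C12_witness_def
  proof (intro conjI allI impI)
    fix t x assume tx: "(t, x) \<in> S"
    have D: "((\<lambda>s. \<phi> (s, x)) has_real_derivative d (t, x)) (at t)"
      "((\<lambda>y. \<phi> (t, y)) has_derivative (\<lambda>h. g (t, x) \<bullet> h)) (at x)"
      "((\<lambda>y. g (t, y)) has_derivative (\<lambda>h. H (t, x) *v h)) (at x)"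
      using W tx by (auto simp: C12_witness_def)
    show "((\<lambda>s. c (fst (s, x)) * \<phi> (s, x)) has_real_derivative c' (fst (t, x)) * \<phi> (t, x) + c (fst (t, x)) * d (t, x)) (at t)"
      by (auto intro!: derivative_eq_intros c D)
    show "((\<lambda>y. c (fst (t, y)) * \<phi> (t, y)) has_derivative (\<lambda>h. (c (fst (t, x)) *\<^sub>R g (t, x)) \<bullet> h)) (at x)"
      by (auto intro!: derivative_eq_intros D)
    show "((\<lambda>y. c (fst (t, y)) *\<^sub>R g (t, y)) has_derivative (\<lambda>h. (c (fst (t, x)) *\<^sub>R H (t, x)) *v h)) (at x)"
      by (auto intro!: derivative_eq_intros D simp: scaleR_matrix_vector_assoc)
  qed (use W in \<open>auto simp: C12_witness_def intro!: continuous_intros cont\<close>)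
qed

section \<open>Functions of the space variable alone, of class C^2, and bump functions\<close>

definition C2_witness :: "(real ^ 'd) set \<Rightarrow> (real ^ 'd \<Rightarrow> real) \<Rightarrow> (real ^ 'd \<Rightarrow> real ^ 'd) \<Rightarrow> (real ^ 'd \<Rightarrow> real ^ 'd ^ 'd) \<Rightarrow> bool" where
  "C2_witness U f g H \<longleftrightarrow>
     (\<forall>x\<in>U. (f has_derivative (\<lambda>h. g x \<bullet> h)) (at x) \<and> (g has_derivative (\<lambda>h. H x *v h)) (at x)) \<and>
     continuous_on U H"

lemma C2_witness_continuous:
  assumes "C2_witness U f g H"
  shows "continuous_on U f" and "continuous_on U g" and "continuous_on U H"
proof -
  have "isCont f x" "isCont g x" if "x \<in> U" for x
    using assms that by (meson C2_witness_def has_derivative_continuous)+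
  then show "continuous_on U f" "continuous_on U g"
    by (auto intro: continuous_at_imp_continuous_on)
  show "continuous_on U H"
    using assms by (simp add: C2_witness_def)
qed

lemma C12_witness_of_C2:
  assumes "C2_witness U f g H" and S: "S \<subseteq> UNIV \<times> U"
  shows "C12_witness S (\<lambda>p. f (snd p)) (\<lambda>p. 0) (\<lambda>p. g (snd p)) (\<lambda>p. H (snd p))"
proof -
  have "continuous_on U f" "continuous_on U g" "continuous_on U H"
    using C2_witness_continuous[OF assms(1)] .
  then have "continuous_on S (\<lambda>p. f (snd p))" "continuous_on S (\<lambda>p. g (snd p))" "continuous_on S (\<lambda>p. H (snd p))"
    using S by (auto intro!: continuous_on_compose2[of U _ S snd] continuous_intros)
  then show ?thesis
    using assms unfolding C12_witness_def C2_witness_def by auto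
qed

text \<open>The two regions in \<open>C12\<close> merge into one open set that reaches beyond time
  T. Gluing is possible because \<open>dt\<close>, \<open>grad\<close> and \<open>hess\<close> are
  fixed functions, whose continuity on two open sets gives continuity on the union.\<close>

lemma C12_iff_witness:
  assumes "open \<Omega>" and "a < T"
  shows "C12 a T \<Omega> \<phi> \<longleftrightarrow>
    (\<exists>S d g H. open S \<and> {a<..T} \<times> \<Omega> \<subseteq> S \<and> S \<subseteq> UNIV \<times> \<Omega> \<and> C12_witness S \<phi> d g H)"
proof
  assume C: "C12 a T \<Omega> \<phi>"
  then obtain V where V: "open V" "{T} \<times> \<Omega> \<subseteq> V" "C12_on V \<phi>" and U: "C12_on ({a<..<T} \<times> \<Omega>) \<phi>"
    by (auto simp: C12_def)
  \<comment> \<open>\<open>V\<close> may leave \<Omega> in space. It is cut down because the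
    majorant \<open>M\<close> added later is smooth over \<Omega> only.\<close>
  let ?U = "{a<..<T} \<times> \<Omega>" let ?V = "V \<inter> (UNIV \<times> \<Omega>)"
  have op: "open ?U" "open ?V"
    using V(1) assms(1) by (auto intro: open_Times)
  have "C12_on ?V \<phi>"
    using V(3) by (auto simp: C12_on_def intro: continuous_on_subset)
  then have "C12_on (?U \<union> ?V) \<phi>"
    using U op unfolding C12_on_def by (auto intro!: continuous_on_open_Un)
  moreover have "open (?U \<union> ?V)" using op by blast
  moreover have "{a<..T} \<times> \<Omega> \<subseteq> ?U \<union> ?V" using V(2) by auto force
  moreover have "?U \<union> ?V \<subseteq> UNIV \<times> \<Omega>" by auto
  ultimately show "\<exists>S d g H. open S \<and> {a<..T} \<times> \<Omega> \<subseteq> S \<and> S \<subseteq> UNIV \<times> \<Omega> \<and> C12_witness S \<phi> d g H"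
    using C12_on_iff_witness by meson
next
  assume "\<exists>S d g H. open S \<and> {a<..T} \<times> \<Omega> \<subseteq> S \<and> S \<subseteq> UNIV \<times> \<Omega> \<and> C12_witness S \<phi> d g H"
  then obtain S where S: "open S" "{a<..T} \<times> \<Omega> \<subseteq> S" "C12_on S \<phi>"
    using C12_on_iff_witness by metis
  have sub: "{a<..<T} \<times> \<Omega> \<subseteq> S" using S(2) by force
  have "C12_on ({a<..<T} \<times> \<Omega>) \<phi>"
    unfolding C12_on_def
  proof (intro conjI ballI)
    fix p assume "p \<in> {a<..<T} \<times> \<Omega>"
    then have "p \<in> S" using sub by blast
    then show "case p of (t, x) \<Rightarrow> (\<lambda>s. \<phi> (s, x)) differentiable at t \<and>
        (\<lambda>y. \<phi> (t, y)) differentiable at x \<and> (\<lambda>y. grad \<phi> (t, y)) differentiable at x"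
      using S(3) unfolding C12_on_def by blast
  qed (use S(3) sub in \<open>auto simp: C12_on_def intro: continuous_on_subset\<close>)
  then show "C12 a T \<Omega> \<phi>"
    using S assms unfolding C12_def by (auto intro!: exI[of _ S])
qed

lemma C12_uminus:
  assumes "open \<Omega>" and "a < T" and "C12 a T \<Omega> \<phi>"
  shows "C12 a T \<Omega> (\<lambda>p. - \<phi> p)"
proof -
  obtain S d g H where S: "open S" "{a<..T} \<times> \<Omega> \<subseteq> S" "S \<subseteq> UNIV \<times> \<Omega>" "C12_witness S \<phi> d g H"
    using iffD1[OF C12_iff_witness[OF assms(1,2)] assms(3)] by blast
  have "C12_witness S (\<lambda>p. -1 * \<phi> p) (\<lambda>p. 0 * \<phi> p + -1 * d p) (\<lambda>p. -1 *\<^sub>R g p) (\<lambda>p. -1 *\<^sub>R H p)"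
    using C12_witness_time_mult[OF S(4), of "\<lambda>t. -1" "\<lambda>t. 0"] by simp
  with S(1-3) show ?thesis
    unfolding C12_iff_witness[OF assms(1,2)] by (simp only: mult_minus1) blast
qed

lemma C2_witness_add:
  assumes "C2_witness U f g H" and "C2_witness U f' g' H'"
  shows "C2_witness U (\<lambda>x. f x + f' x) (\<lambda>x. g x + g' x) (\<lambda>x. H x + H' x)"
  using assms unfolding C2_witness_def
  by (auto intro!: has_derivative_eq_rhs[OF has_derivative_add] continuous_on_add
      simp: inner_add_left matrix_vector_mult_add_rdistrib)

lemma C2_witness_zero: "C2_witness U (\<lambda>x. 0) (\<lambda>x. 0) (\<lambda>x. 0)"
  by (auto simp: C2_witness_def)

lemma C2_witness_scale:
  assumes "C2_witness U f g H"
  shows "C2_witness U (\<lambda>x. c * f x) (\<lambda>x. c *\<^sub>R g x) (\<lambda>x. c *\<^sub>R H x)"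
  using assms unfolding C2_witness_def
  by (auto intro!: derivative_eq_intros continuous_intros simp: scaleR_matrix_vector_assoc)

lemma C2_witness_norm_sq:
  "C2_witness U (\<lambda>x. (norm (x - y))\<^sup>2) (\<lambda>x. 2 *\<^sub>R (x - y)) (\<lambda>x. 2 *\<^sub>R mat 1)"
  unfolding C2_witness_def power2_norm_eq_inner
  by (auto intro!: derivative_eq_intros simp: inner_commute simp flip: scaleR_matrix_vector_assoc)

text \<open>The tensor product of two vectors: the rank-one term that appears in the Hessian of a
  composition when the factor \<open>b' (f x)\<close> of the gradient is differentiated.\<close>

definition outer :: "real ^ 'd \<Rightarrow> real ^ 'd \<Rightarrow> real ^ 'd ^ 'd" where
  "outer v w = (\<chi> i j. v $ i * w $ j)"

lemma outer_mult: "outer v w *v h = (w \<bullet> h) *\<^sub>R v"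
  by (simp add: outer_def vec_eq_iff matrix_vector_mult_def inner_vec_def sum_distrib_left mult_ac)

lemma continuous_on_outer [continuous_intros]:
  assumes "continuous_on S f" "continuous_on S g"
  shows "continuous_on S (\<lambda>x. outer (f x) (g x))"
  unfolding outer_def by (intro continuous_intros assms)

lemma C2_witness_compose:
  assumes W: "C2_witness U f g H"
    and b: "\<And>r. (b has_real_derivative b' r) (at r)" and b': "\<And>r. (b' has_real_derivative b'' r) (at r)"
    and b'': "continuous_on UNIV b''"
  shows "C2_witness U (\<lambda>x. b (f x)) (\<lambda>x. b' (f x) *\<^sub>R g x)
     (\<lambda>x. b'' (f x) *\<^sub>R outer (g x) (g x) + b' (f x) *\<^sub>R H x)"
proof -
  have D: "(f has_derivative (\<lambda>h. g x \<bullet> h)) (at x)" "(g has_derivative (\<lambda>h. H x *v h)) (at x)" if "x \<in> U" for x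
    using W that by (auto simp: C2_witness_def)
  note fg = C2_witness_continuous(1,2)[OF W]
  have "continuous_on UNIV b'"
    using b' by (meson DERIV_continuous_on has_field_derivative_at_within)
  then have cont: "continuous_on U (\<lambda>x. b' (f x))" "continuous_on U (\<lambda>x. b'' (f x))"
    using b'' by (auto intro!: continuous_on_compose2[OF _ fg(1)])
  have comp: "((\<lambda>y. c (f y)) has_derivative (\<lambda>h. c' * (g x \<bullet> h))) (at x)"
    if "x \<in> U" "(c has_real_derivative c') (at (f x))" for c c' x
    using has_derivative_compose[OF D(1)[OF that(1)], of c "\<lambda>h. c' * h"] that(2)
    by (simp add: has_field_derivative_def)
  have [simp]: "((A + B) *v h) = A *v h + B *v h" for A B :: "real ^ 'd ^ 'd" and h
    by (rule matrix_vector_mult_add_rdistrib)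
  show ?thesis
    unfolding C2_witness_def
  proof (intro conjI ballI)
    fix x assume x: "x \<in> U"
    show "((\<lambda>x. b (f x)) has_derivative (\<lambda>h. (b' (f x) *\<^sub>R g x) \<bullet> h)) (at x)"
      using comp[OF x b] by simp
    show "((\<lambda>x. b' (f x) *\<^sub>R g x) has_derivative
        (\<lambda>h. (b'' (f x) *\<^sub>R outer (g x) (g x) + b' (f x) *\<^sub>R H x) *v h)) (at x)"
      by (rule has_derivative_eq_rhs[OF has_derivative_scaleR[OF comp[OF x b'] D(2)[OF x]]])
         (simp add: fun_eq_iff outer_mult flip: scaleR_matrix_vector_assoc)
  next
    show "continuous_on U (\<lambda>x. b'' (f x) *\<^sub>R outer (g x) (g x) + b' (f x) *\<^sub>R H x)"
      using W fg cont by (intro continuous_intros) (auto simp: C2_witness_def)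
  qed
qed

text \<open>At 0 the difference quotient is bounded by \<open>(max 0 h) ^ n\<close>, which tends to
  0 because n is at least 1. Powers of the positive part thus provide cutoffs of any prescribed
  finite smoothness.\<close>

lemma DERIV_max_power:
  assumes "n \<ge> 1"
  shows "((\<lambda>r::real. (max 0 r) ^ Suc n) has_real_derivative real (Suc n) * (max 0 r) ^ n) (at r)"
proof -
  consider "r < 0" | "r = 0" | "r > 0" by linarith
  then show ?thesis
  proof cases
    case 1
    have "((\<lambda>r::real. 0) has_real_derivative real (Suc n) * (max 0 r) ^ n) (at r)"
      using 1 assms by (simp add: power_0_left)
    then show ?thesis
      by (rule has_field_derivative_transform_within_open[of _ _ _ "{..<0}"]) (use 1 in auto)
  next
    case 2
    have "((\<lambda>h. (max 0 h) ^ Suc n / h) \<longlongrightarrow> 0) (at (0::real))"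
    proof (rule Lim_null_comparison)
      show "\<forall>\<^sub>F h in at 0. norm ((max 0 h) ^ Suc n / h) \<le> (max 0 h) ^ n" for h :: real
        by (auto simp: eventually_at_filter max_def)
      have "((\<lambda>h::real. (max 0 h) ^ n) \<longlongrightarrow> (max 0 0) ^ n) (at 0)"
        by (intro tendsto_intros)
      then show "((\<lambda>h::real. (max 0 h) ^ n) \<longlongrightarrow> 0) (at 0)"
        using assms by (simp add: power_0_left)
    qed
    then show ?thesis
      using 2 assms by (simp add: DERIV_def power_0_left)
  next
    case 3
    have "((\<lambda>r::real. r ^ Suc n) has_real_derivative real (Suc n) * (max 0 r) ^ n) (at r)"
      using 3 DERIV_power[OF DERIV_ident, of "Suc n" r UNIV] by (simp add: mult_ac)
    then show ?thesis
      by (rule has_field_derivative_transform_within_open[of _ _ _ "{0<..}"]) (use 3 in auto)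
  qed
qed

text \<open>The bump is the cube of the positive part of
  \<open>r\<^sup>2 - (norm (x - y))\<^sup>2\<close>; with exponent 3 the second derivative
  \<open>6 * max 0 s\<close> of the outer function is still continuous.\<close>

lemma C2_bump:
  fixes y :: "real ^ 'd"
  assumes "0 < r"
  obtains f g H where "C2_witness UNIV f g H" "\<And>x. f x \<ge> 0" "\<And>x. x \<notin> ball y r \<Longrightarrow> f x = 0" "f y > 0"
proof -
  let ?b = "\<lambda>s::real. (max 0 s) ^ 3"
  let ?f = "\<lambda>x. r\<^sup>2 + (-1) * (norm (x - y))\<^sup>2"
  have b1: "(?b has_real_derivative 3 * (max 0 s)\<^sup>2) (at s)" for s
    using DERIV_max_power[of 2 s] by (simp add: numeral_3_eq_3 numeral_2_eq_2)
  have "((\<lambda>s. (max 0 s)\<^sup>2) has_real_derivative 2 * max 0 s) (at s)" for s :: real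
    using DERIV_max_power[of 1 s] by (simp add: numeral_2_eq_2)
  then have b2: "((\<lambda>s. 3 * (max 0 s)\<^sup>2) has_real_derivative 6 * max 0 s) (at s)" for s :: real
    using DERIV_cmult[of "\<lambda>s. (max 0 s)\<^sup>2" "2 * max 0 s" s UNIV 3] by simp
  have "C2_witness UNIV (\<lambda>x::real^'d. r\<^sup>2) (\<lambda>x. 0) (\<lambda>x. 0)"
    by (auto simp: C2_witness_def)
  from C2_witness_add[OF this C2_witness_scale[OF C2_witness_norm_sq[of _ y], where c = "-1"]]
  obtain g H where W: "C2_witness UNIV ?f g H" by blast
  have "continuous_on UNIV (\<lambda>s::real. 6 * max 0 s)" by (intro continuous_intros)
  from C2_witness_compose[OF W b1 b2 this]
  obtain g H where "C2_witness UNIV (\<lambda>x. ?b (?f x)) g H" by blast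
  then show ?thesis
  proof (rule that)
    show "?b (?f x) = 0" if "x \<notin> ball y r" for x
    proof -
      have "r\<^sup>2 \<le> (norm (x - y))\<^sup>2"
        using that assms by (intro power_mono) (auto simp: dist_norm norm_minus_commute)
      then show ?thesis by simp
    qed
  qed (use assms in auto)
qed

section \<open>Semicontinuous envelopes and smooth majorants\<close>

text \<open>Upper semicontinuity of a real-valued function in epsilon-delta form. Once the envelope
  is known to be finite, this replaces the extended-real envelope in all later arguments.\<close>

definition usc_on :: "'m::metric_space set \<Rightarrow> ('m \<Rightarrow> real) \<Rightarrow> bool" where
  "usc_on A v \<longleftrightarrow> (\<forall>p\<in>A. \<forall>e>0. \<exists>\<delta>>0. \<forall>q\<in>A. dist q p < \<delta> \<longrightarrow> v q < v p + e)"

text \<open>The suprema increase with the radius, so the one-sided limit in the definition exists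
  and is an infimum.\<close>

lemma usc_env_eq_INF:
  "usc_env A h x = (INF \<sigma>\<in>{0<..}. SUP y\<in>A \<inter> cball x \<sigma>. ereal (h y))"
proof -
  let ?f = "\<lambda>\<sigma>. SUP y\<in>A \<inter> cball x \<sigma>. ereal (h y)"
  have mono: "?f a \<le> ?f b" if "a \<le> b" for a b
    by (rule SUP_subset_mono) (use that in auto)
  have "(?f \<longlongrightarrow> Inf (?f ` ({0<..} \<inter> UNIV))) (at 0 within ({0<..} \<inter> UNIV))"
    by (rule Lim_right_bound[where K = "-\<infinity>"]) (auto intro: mono)
  then show ?thesis
    unfolding usc_env_def by (intro tendsto_Lim) auto
qed

lemma usc_env_ge:
  assumes "p \<in> A"
  shows "ereal (h p) \<le> usc_env A h p"
  unfolding usc_env_eq_INF using assms by (intro INF_greatest SUP_upper) auto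

text \<open>If the supremum over the ball of radius \<sigma> about p is small and q is closer to p
  than \<sigma>/2, then the ball of radius \<sigma>/2 about q lies in the former ball, so the
  envelope at q is small too.\<close>

lemma usc_on_usc_env:
  assumes fin: "\<And>p. p \<in> A \<Longrightarrow> usc_env A h p < \<infinity>"
  shows "usc_on A (\<lambda>p. real_of_ereal (usc_env A h p))"
  unfolding usc_on_def
proof (intro ballI allI impI)
  fix p and e :: real assume p: "p \<in> A" and e: "0 < e"
  let ?v = "\<lambda>p. real_of_ereal (usc_env A h p)"
  \<comment> \<open>No default value of \<open>real_of_ereal\<close> is met:
    \<open>usc_env_ge\<close> rules out minus infinity and \<open>fin\<close> rules out
    infinity.\<close>
  have v: "ereal (?v q) = usc_env A h q" if "q \<in> A" for q
    using usc_env_ge[OF that, of h] fin[OF that] by (intro ereal_real') auto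
  have "usc_env A h p < ereal (?v p + e)"
    using v[OF p] e by (metis ereal_less(2) less_add_same_cancel1 less_ereal.simps(1))
  then obtain \<sigma> where \<sigma>: "\<sigma> > 0" "(SUP y\<in>A \<inter> cball p \<sigma>. ereal (h y)) < ereal (?v p + e)"
    unfolding usc_env_eq_INF by (auto simp: INF_less_iff)
  show "\<exists>\<delta>>0. \<forall>q\<in>A. dist q p < \<delta> \<longrightarrow> ?v q < ?v p + e"
  proof (intro exI[of _ "\<sigma> / 2"] conjI ballI impI)
    fix q assume q: "q \<in> A" "dist q p < \<sigma> / 2"
    have "cball q (\<sigma> / 2) \<subseteq> cball p \<sigma>"
    proof
      fix y assume "y \<in> cball q (\<sigma> / 2)"
      then show "y \<in> cball p \<sigma>"
        using q(2) dist_triangle[of p y q] by (simp add: dist_commute)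
    qed
    then have "(SUP y\<in>A \<inter> cball q (\<sigma> / 2). ereal (h y)) \<le> (SUP y\<in>A \<inter> cball p \<sigma>. ereal (h y))"
      by (intro SUP_subset_mono) auto
    moreover have "usc_env A h q \<le> (SUP y\<in>A \<inter> cball q (\<sigma> / 2). ereal (h y))"
      unfolding usc_env_eq_INF using \<sigma>(1) by (intro INF_lower) auto
    ultimately have "ereal (?v q) < ereal (?v p + e)"
      using \<sigma>(2) v[OF q(1)] by (metis le_less_trans order_trans)
    then show "?v q < ?v p + e" by simp
  qed (use \<sigma> in auto)
qed

lemma usc_on_bounded_above:
  assumes "usc_on A v" and "compact C" and "C \<subseteq> A"
  obtains B where "\<And>p. p \<in> C \<Longrightarrow> v p \<le> B"
proof -
  have "\<forall>p\<in>C. \<exists>\<delta>>0. \<forall>q\<in>A. dist q p < \<delta> \<longrightarrow> v q < v p + 1"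
    using assms(1,3) unfolding usc_on_def by (meson subsetD zero_less_one)
  then obtain \<delta> where \<delta>: "\<And>p. p \<in> C \<Longrightarrow> \<delta> p > 0"
    "\<And>p q. p \<in> C \<Longrightarrow> q \<in> A \<Longrightarrow> dist q p < \<delta> p \<Longrightarrow> v q < v p + 1"
    by metis
  obtain C' where C': "C' \<subseteq> C" "finite C'" "C \<subseteq> (\<Union>c\<in>C'. ball c (\<delta> c))"
    using compactE_image[OF assms(2), of C "\<lambda>c. ball c (\<delta> c)"] \<delta>(1) by force
  show ?thesis
  proof (rule that)
    fix p assume p: "p \<in> C"
    then obtain c where c: "c \<in> C'" "dist c p < \<delta> c" using C'(3) by auto
    then have "v p \<le> v c + 1"
      using \<delta>(2)[of c p] p C'(1) assms(3) by (force simp: dist_commute)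
    \<comment> \<open>The sum of absolute values stands in for a maximum over the finite cover, so
      an empty cover is no special case.\<close>
    also have "\<dots> \<le> (\<Sum>c\<in>C'. \<bar>v c + 1\<bar>)"
      using member_le_sum[OF c(1), of "\<lambda>c. \<bar>v c + 1\<bar>"] C'(2) by simp
    finally show "v p \<le> (\<Sum>c\<in>C'. \<bar>v c + 1\<bar>)" .
  qed
qed

section \<open>Gluing, and smooth majorants of functions bounded above on compact sets\<close>

lemma C12_witness_cong:
  assumes S: "open S" and eq: "\<And>p. p \<in> S \<Longrightarrow> \<phi> p = \<psi> p" and W: "C12_witness S \<phi> d g H"
  shows "C12_witness S \<psi> d g H"
  unfolding C12_witness_def
proof (intro conjI allI impI)
  fix t x assume tx: "(t, x) \<in> S"
  have D: "((\<lambda>s. \<phi> (s, x)) has_real_derivative d (t, x)) (at t)"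
    "((\<lambda>y. \<phi> (t, y)) has_derivative (\<lambda>h. g (t, x) \<bullet> h)) (at x)"
    "((\<lambda>y. g (t, y)) has_derivative (\<lambda>h. H (t, x) *v h)) (at x)"
    using W tx by (auto simp: C12_witness_def)
  have "open ((\<lambda>s. (s, x)) -` S)"
    by (rule open_vimage[OF S]) (intro continuous_intros)
  then show "((\<lambda>s. \<psi> (s, x)) has_real_derivative d (t, x)) (at t)"
    by (rule has_field_derivative_transform_within_open[OF D(1)]) (use tx eq in auto)
  show "((\<lambda>y. \<psi> (t, y)) has_derivative (\<lambda>h. g (t, x) \<bullet> h)) (at x)"
  proof (rule has_derivative_transform_nhds[OF D(2)])
    show "\<forall>\<^sub>F y in nhds x. \<phi> (t, y) = \<psi> (t, y)"
      using eventually_slice[OF S tx] by eventually_elim (simp add: eq)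
  qed
  show "((\<lambda>y. g (t, y)) has_derivative (\<lambda>h. H (t, x) *v h)) (at x)" by fact
qed (use W eq in \<open>auto simp: C12_witness_def cong: continuous_on_cong\<close>)

text \<open>Stated for \<open>C12_on\<close> rather than for witnesses: its derivatives are
  canonical functions, hence agree on overlaps.\<close>

lemma C12_on_Union:
  assumes "\<And>S. S \<in> \<S> \<Longrightarrow> open S" and C: "\<And>S. S \<in> \<S> \<Longrightarrow> C12_on S \<phi>"
  shows "C12_on (\<Union>\<S>) \<phi>"
  unfolding C12_on_def
proof (intro conjI ballI)
  fix p assume "p \<in> \<Union>\<S>"
  then show "case p of (t, x) \<Rightarrow> (\<lambda>s. \<phi> (s, x)) differentiable at t \<and>
      (\<lambda>y. \<phi> (t, y)) differentiable at x \<and> (\<lambda>y. grad \<phi> (t, y)) differentiable at x"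
    using C unfolding C12_on_def by blast
qed (auto intro!: continuous_on_open_Union assms(1) dest: C simp: C12_on_def)

definition C2_on :: "(real ^ 'd) set \<Rightarrow> (real ^ 'd \<Rightarrow> real) \<Rightarrow> bool" where
  "C2_on U f \<longleftrightarrow> (\<exists>g H. C2_witness U f g H)"

lemma C2_on_sum:
  assumes "\<And>i. i \<in> I \<Longrightarrow> C2_on U (f i)"
  shows "C2_on U (\<lambda>x. \<Sum>i\<in>I. f i x)"
  using assms
proof (induction I rule: infinite_finite_induct)
  case (insert i I)
  then obtain g H g' H' where "C2_witness U (f i) g H" "C2_witness U (\<lambda>x. \<Sum>i\<in>I. f i x) g' H'"
    unfolding C2_on_def by (metis insertCI)
  from C2_witness_add[OF this] show ?case
    using insert by (auto simp: C2_on_def)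
qed (auto simp: C2_on_def intro: C2_witness_zero)

text \<open>Around each point of \<open>C\<close> a bump supported away from \<open>Z\<close> is
  scaled to exceed \<open>B\<close> near that point; by compactness finitely many bumps suffice, and
  their sum dominates since all are nonnegative.\<close>

lemma C2_dominating_compact:
  fixes C Z :: "(real ^ 'd) set"
  assumes C: "compact C" and Z: "closed Z" and disj: "C \<inter> Z = {}"
  obtains f where "C2_on UNIV f" "\<And>x. f x \<ge> 0" "\<And>x. x \<in> C \<Longrightarrow> B \<le> f x" "\<And>x. x \<in> Z \<Longrightarrow> f x = 0"
proof -
  have "\<exists>f. C2_on UNIV f \<and> (\<forall>x. 0 \<le> f x) \<and> (\<forall>x\<in>Z. f x = 0) \<and> B < f y" if y: "y \<in> C" for y
  proof -
    obtain r where r: "r > 0" "ball y r \<subseteq> - Z"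
      using open_contains_ball[of "- Z"] Z y disj open_Compl by (metis ComplI disjoint_iff)
    obtain f g H where f: "C2_witness UNIV f g H" "\<And>x. f x \<ge> 0" "\<And>x. x \<notin> ball y r \<Longrightarrow> f x = 0" "f y > 0"
      using C2_bump[OF r(1)] by metis
    \<comment> \<open>This factor gives the bump the value \<bar>B\<bar> + 1 at y, which exceeds
      \<open>B\<close> whatever its sign.\<close>
    let ?c = "(\<bar>B\<bar> + 1) / f y"
    have "C2_on UNIV (\<lambda>x. ?c * f x)"
      using C2_witness_scale[OF f(1)] unfolding C2_on_def by blast
    moreover have "?c * f x = 0" if "x \<in> Z" for x
      using f(3)[of x] that r(2) by (metis ComplD mult_zero_right subsetD)
    moreover have "0 \<le> ?c * f x" for x using f(2)[of x] f(4) by simp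
    moreover have "B < ?c * f y" using f(4) by simp
    ultimately show ?thesis by (intro exI[of _ "\<lambda>x. ?c * f x"]) blast
  qed
  then obtain f where f: "\<And>y. y \<in> C \<Longrightarrow> C2_on UNIV (f y)" "\<And>y x. y \<in> C \<Longrightarrow> 0 \<le> f y x"
    "\<And>y x. y \<in> C \<Longrightarrow> x \<in> Z \<Longrightarrow> f y x = 0" "\<And>y. y \<in> C \<Longrightarrow> B < f y y"
    by metis
  have op: "open {x. B < f y x}" if "y \<in> C" for y
  proof -
    have "continuous_on UNIV (f y)"
      using f(1)[OF that] C2_witness_continuous(1) by (auto simp: C2_on_def)
    then show ?thesis by (intro open_Collect_less continuous_on_const)
  qed
  obtain C' where C': "C' \<subseteq> C" "finite C'" "C \<subseteq> (\<Union>y\<in>C'. {x. B < f y x})"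
  proof (rule compactE_image[OF C op])
    show "C \<subseteq> (\<Union>y\<in>C. {x. B < f y x})" using f(4) by blast
  qed  show ?thesis
  proof (rule that)
    show "C2_on UNIV (\<lambda>x. \<Sum>y\<in>C'. f y x)"
      using f(1) C'(1) by (intro C2_on_sum) auto
    show "0 \<le> (\<Sum>y\<in>C'. f y x)" for x
      using f(2) C'(1) by (intro sum_nonneg) auto
    show "(\<Sum>y\<in>C'. f y x) = 0" if "x \<in> Z" for x
      using f(3) C'(1) that by (intro sum.neutral) auto
    show "B \<le> (\<Sum>y\<in>C'. f y x)" if x: "x \<in> C" for x
    proof -
      obtain y where y: "y \<in> C'" "B < f y x" using C'(3) x by blast
      have "f y x \<le> (\<Sum>y\<in>C'. f y x)"
        using f(2) C' by (intro member_le_sum y(1)) auto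
      then show ?thesis using y(2) by simp
    qed
  qed
qed

text \<open>Exhaust \<Omega> by compact sets \<open>C n\<close>. The function \<open>f n\<close>
  exceeds the bound \<open>B n\<close> on the shell between \<open>C n\<close> and
  \<open>C (Suc n)\<close> and vanishes on \<open>C (n - 1)\<close>. The sum is therefore locally
  finite, hence smooth, and every point lies in the shell just below the first \<open>C k\<close>
  containing it.\<close>

lemma C2_dominating:
  fixes m :: "real ^ 'd \<Rightarrow> 'b \<Rightarrow> real"
  assumes \<Omega>: "open \<Omega>" and m: "\<And>K. compact K \<Longrightarrow> K \<subseteq> \<Omega> \<Longrightarrow> \<exists>B. \<forall>x\<in>K. \<forall>s\<in>I. m x s \<le> B"
  obtains M where "C12_on (UNIV \<times> \<Omega>) (\<lambda>p. M (snd p))" "\<And>x s. x \<in> \<Omega> \<Longrightarrow> s \<in> I \<Longrightarrow> m x s \<le> M x"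
proof -
  obtain K where K: "\<And>n. compact (K n)" "\<And>n. K n \<subseteq> \<Omega>" "\<And>n. K n \<subseteq> interior (K (Suc n))" "\<Union>(range K) = \<Omega>"
    using open_Union_compact_subsets[OF \<Omega>] by metis
  \<comment> \<open>The empty set is put in front so that the first shell is all of
    \<open>K 0\<close> and the least index of a set containing a given point is a successor.\<close>
  define C where "C = case_nat {} K"
  have C: "compact (C n)" "C n \<subseteq> \<Omega>" "C n \<subseteq> interior (C (Suc n))" for n
    using K by (auto simp: C_def split: nat.split)
  have C0: "C 0 = {}" by (simp add: C_def)
  have CU: "\<exists>n. x \<in> C n" if x: "x \<in> \<Omega>" for x
  proof -
    obtain n where "x \<in> K n" using K(4) x by blast
    then show ?thesis by (intro exI[of _ "Suc n"]) (simp add: C_def)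
  qed
  have mono: "C i \<subseteq> C j" if "i \<le> j" for i j
    using lift_Suc_mono_le[of C, OF _ that] C(3) interior_subset by (meson order_trans)
  have "\<exists>B. \<forall>x\<in>C (Suc n). \<forall>s\<in>I. m x s \<le> B" for n
    by (rule m) (use C in auto)
  then obtain B where B: "\<And>n x s. x \<in> C (Suc n) \<Longrightarrow> s \<in> I \<Longrightarrow> m x s \<le> B n"
    by metis
  \<comment> \<open>The closed shell may touch \<open>C n\<close>, but it misses
    \<open>C (n - 1)\<close>, which lies in the interior of \<open>C n\<close>. For n = 0 truncated
    subtraction gives \<open>C 0\<close>, which is empty, so vanishing there is no
    condition.\<close>
  have "\<exists>f. C2_on UNIV f \<and> (\<forall>x. 0 \<le> f x) \<and> (\<forall>x\<in>C (Suc n) - interior (C n). B n \<le> f x) \<and> (\<forall>x\<in>C (n - 1). f x = 0)" for n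
  proof -
    have "compact (C (Suc n) - interior (C n))"
      using C(1) by (intro compact_diff) auto
    moreover have "closed (C (n - 1))" using C(1) compact_imp_closed by blast
    moreover have "(C (Suc n) - interior (C n)) \<inter> C (n - 1) = {}"
      using C(3) C0 by (cases n) auto
    ultimately show ?thesis
      by (rule C2_dominating_compact[where B = "B n"]) blast
  qed
  then obtain f where f: "\<And>n. C2_on UNIV (f n)" "\<And>n x. 0 \<le> f n x"
    "\<And>n x. x \<in> C (Suc n) - interior (C n) \<Longrightarrow> B n \<le> f n x" "\<And>n x. x \<in> C (n - 1) \<Longrightarrow> f n x = 0"
    by metis
  \<comment> \<open>For points of \<Omega> the index set is finite. Elsewhere it may be infinite and
    the sum may take its default value 0, but nothing is claimed about such points.\<close>
  define M where "M = (\<lambda>x. \<Sum>n | f n x \<noteq> 0. f n x)"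
  have zero: "f n x = 0" if "x \<in> C k" "k < n" for n k x
    using subsetD[OF mono[of k "n - 1"] that(1)] that(2) by (intro f(4)) simp
  have M: "M x = (\<Sum>n\<le>k. f n x)" if "x \<in> C k" for x k
    unfolding M_def
  proof (rule sum.mono_neutral_left)
    show "{n. f n x \<noteq> 0} \<subseteq> {..k}"
      using zero[OF that] by (force simp: not_le[symmetric])
  qed auto
  show ?thesis
  proof (rule that)
    have "C12_on (UNIV \<times> interior (C k)) (\<lambda>p. M (snd p))" for k
    proof -
      have op: "open (UNIV \<times> interior (C k) :: (real \<times> (real ^ 'd)) set)"
        by (intro open_Times) auto
      obtain g H where W: "C2_witness UNIV (\<lambda>x. \<Sum>n\<le>k. f n x) g H"
        using C2_on_sum[of "{..k}" UNIV f] f(1) by (auto simp: C2_on_def)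
      have "(\<Sum>n\<le>k. f n (snd p)) = M (snd p)" if "p \<in> UNIV \<times> interior (C k)" for p :: "real \<times> (real ^ 'd)"
        using that interior_subset[of "C k"] by (intro M[symmetric]) auto
      from C12_witness_cong[OF op this C12_witness_of_C2[OF W]]
      have "C12_witness (UNIV \<times> interior (C k)) (\<lambda>p. M (snd p)) (\<lambda>p. 0) (\<lambda>p. g (snd p)) (\<lambda>p. H (snd p))"
        by simp
      then show ?thesis
        unfolding C12_on_iff_witness[OF op] by blast
    qed
    then have "C12_on (\<Union>k. UNIV \<times> interior (C k)) (\<lambda>p. M (snd p))"
      by (intro C12_on_Union) (auto intro: open_Times)
    moreover have "(\<Union>k. interior (C k)) = \<Omega>"
    proof
      show "(\<Union>k. interior (C k)) \<subseteq> \<Omega>" using C(2) interior_subset by fast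
      show "\<Omega> \<subseteq> (\<Union>k. interior (C k))" using CU C(3) by fast
    qed
    then have "(\<Union>k. UNIV \<times> interior (C k)) = (UNIV :: real set) \<times> \<Omega>" by blast
    ultimately show "C12_on (UNIV \<times> \<Omega>) (\<lambda>p. M (snd p))" by simp
    fix x s assume x: "x \<in> \<Omega>" and s: "s \<in> I"
    define k where "k = (LEAST k. x \<in> C k)"
    have k: "x \<in> C k" unfolding k_def using CU[OF x] by (rule LeastI_ex)
    then obtain n where n: "k = Suc n" using C0 by (cases k) auto
    have "x \<notin> C n"
      using not_less_Least[of n "\<lambda>k. x \<in> C k"] n by (auto simp: k_def)
    then have "x \<in> C (Suc n) - interior (C n)"
      using k n interior_subset by blast
    then have "m x s \<le> f n x" using f(3) B[OF _ s] by (metis DiffD1 order_trans)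
    also have "\<dots> \<le> M x"
      unfolding M[OF k] using f(2) n by (intro member_le_sum) auto
    finally show "m x s \<le> M x" .
  qed
qed

text \<open>The step is \<open>p / (p + q)\<close> with p and q the squared positive parts of the
  distances past \<open>t\<^sub>1\<close> and before \<open>t\<^sub>2\<close>. Since
  \<open>t\<^sub>1 < t\<^sub>2\<close>, one of the two is positive at every time. The quotient has
  one continuous derivative, as the class asks for in time.\<close>

lemma smooth_step:
  fixes t\<^sub>1 t\<^sub>2 :: real
  assumes "t\<^sub>1 < t\<^sub>2"
  obtains c c' where "\<And>t. (c has_real_derivative c' t) (at t)" "continuous_on UNIV c'"
    "\<And>t. 0 \<le> c t" "\<And>t. c t \<le> 1" "\<And>t. t \<le> t\<^sub>1 \<Longrightarrow> c t = 0" "\<And>t. t\<^sub>2 \<le> t \<Longrightarrow> c t = 1"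
proof -
  define p q where "p = (\<lambda>t. (max 0 (t - t\<^sub>1))\<^sup>2)" and "q = (\<lambda>t. (max 0 (t\<^sub>2 - t))\<^sup>2)"
  define p' q' where "p' = (\<lambda>t. 2 * max 0 (t - t\<^sub>1))" and "q' = (\<lambda>t. - 2 * max 0 (t\<^sub>2 - t))"
  have sq: "((\<lambda>s. (max 0 s)\<^sup>2) has_real_derivative 2 * max 0 s) (at s)" for s :: real
    using DERIV_max_power[of 1 s] by (simp add: numeral_2_eq_2)
  have "((\<lambda>t. t - t\<^sub>1) has_real_derivative 1) (at t)" "((\<lambda>t. t\<^sub>2 - t) has_real_derivative - 1) (at t)" for t
    by (auto intro!: derivative_eq_intros)
  from DERIV_chain2[OF sq this(1)] DERIV_chain2[OF sq this(2)]
  have p: "(p has_real_derivative p' t) (at t)" and q: "(q has_real_derivative q' t) (at t)" for t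
    by (simp_all add: p_def q_def p'_def q'_def)
  have pos: "p t + q t > 0" for t
  proof (cases "t > t\<^sub>1")
    case True
    then show ?thesis by (auto simp: p_def q_def intro!: add_pos_nonneg)
  next
    case False
    then show ?thesis using assms by (auto simp: p_def q_def)
  qed
  have cont: "continuous_on UNIV p" "continuous_on UNIV q" "continuous_on UNIV p'" "continuous_on UNIV q'"
    unfolding p_def q_def p'_def q'_def by (intro continuous_intros)+
  show ?thesis
  proof (rule that)
    show "((\<lambda>t. p t / (p t + q t)) has_real_derivative
        (p' t * (p t + q t) - p t * (p' t + q' t)) / ((p t + q t) * (p t + q t))) (at t)" for t
      using pos[of t] by (intro DERIV_divide DERIV_add p q) auto
    show "continuous_on UNIV (\<lambda>t. (p' t * (p t + q t) - p t * (p' t + q' t)) / ((p t + q t) * (p t + q t)))"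
      using pos by (intro continuous_intros cont) (auto simp: less_le)
    show "0 \<le> p t / (p t + q t)" for t by (simp add: p_def q_def)
    show "p t / (p t + q t) \<le> 1" for t using pos[of t] by (simp add: q_def)
    show "p t / (p t + q t) = 0" if "t \<le> t\<^sub>1" for t using that by (simp add: p_def)
    show "p t / (p t + q t) = 1" if "t\<^sub>2 \<le> t" for t using pos[of t] that by (simp add: q_def)
  qed
qed

section \<open>The nonlocal operator\<close>

text \<open>Dominated convergence, with the absolute value of the integrand on the full interval as
  bound. For integrable integrands it identifies the singular limit \<open>K0\<close> with the plain
  integral \<open>K \<alpha> 0 t\<close>.\<close>

lemma set_integral_Ioo_tendsto_at_right:
  fixes f :: "real \<Rightarrow> real"
  assumes "c < t" and f: "set_integrable lebesgue {c<..<t} f"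
  shows "((\<lambda>b. set_lebesgue_integral lebesgue {b<..<t} f) \<longlongrightarrow> set_lebesgue_integral lebesgue {c<..<t} f) (at_right c)"
proof (rule tendsto_at_right_sequentially[OF \<open>c < t\<close>])
  fix S :: "nat \<Rightarrow> real"
  assume S: "\<And>n. c < S n" "\<And>n. S n < t" "decseq S" "S \<longlonglongrightarrow> c"
  show "(\<lambda>n. set_lebesgue_integral lebesgue {S n<..<t} f) \<longlonglongrightarrow> set_lebesgue_integral lebesgue {c<..<t} f"
    unfolding set_lebesgue_integral_def
  proof (rule integral_dominated_convergence[where w="\<lambda>x. \<bar>indicator {c<..<t} x * f x\<bar>"])
    show "(\<lambda>x. indicator {c<..<t} x *\<^sub>R f x) \<in> borel_measurable lebesgue"
      using f by (auto simp: set_integrable_def)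
    have sub: "set_integrable lebesgue {S n<..<t} f" for n
      by (rule set_integrable_subset[OF f]) (use S(1)[of n] in auto)
    show "(\<lambda>x. indicator {S n<..<t} x *\<^sub>R f x) \<in> borel_measurable lebesgue" for n
      using sub[of n] by (auto simp: set_integrable_def)
    show "integrable lebesgue (\<lambda>x. \<bar>indicator {c<..<t} x * f x\<bar>)"
      using f by (auto simp: set_integrable_def intro: integrable_abs)
    show "AE x in lebesgue. (\<lambda>n. indicator {S n<..<t} x *\<^sub>R f x) \<longlonglongrightarrow> indicator {c<..<t} x *\<^sub>R f x"
    proof (rule AE_I2)
      fix x
      show "(\<lambda>n. indicator {S n<..<t} x *\<^sub>R f x) \<longlonglongrightarrow> indicator {c<..<t} x *\<^sub>R f x"
      proof (cases "c < x")
        case True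
        have "\<forall>\<^sub>F n in sequentially. S n < x"
          using order_tendstoD(2)[OF S(4) True] .
        then have "\<forall>\<^sub>F n in sequentially. indicator {S n<..<t} x *\<^sub>R f x = indicator {c<..<t} x *\<^sub>R f x"
          by eventually_elim (use True in \<open>auto simp: indicator_def\<close>)
        then show ?thesis by (rule tendsto_eventually)
      next
        case False
        then have "indicator {S n<..<t} x *\<^sub>R f x = indicator {c<..<t} x *\<^sub>R f x" for n
          using S(1)[of n] by (auto simp: indicator_def)
        then show ?thesis by (simp only: tendsto_const)
      qed
    qed
    show "AE x in lebesgue. norm (indicator {S n<..<t} x *\<^sub>R f x) \<le> \<bar>indicator {c<..<t} x * f x\<bar>" for n
      using S(1)[of n] by (intro AE_I2) (auto simp: indicator_def)
  qed
qed

lemma K_tendsto_of_integrable: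
  assumes "0 < t" and "set_integrable lebesgue {0<..<t} (K_integrand \<alpha> f t)"
  shows "((\<lambda>b. K \<alpha> b t f t) \<longlongrightarrow> K \<alpha> 0 t f t) (at_right 0)"
  unfolding K_def
  by (intro tendsto_intros set_integral_Ioo_tendsto_at_right assms)

lemma K0_eq_K:
  assumes "0 < t" and "set_integrable lebesgue {0<..<t} (K_integrand \<alpha> f t)"
  shows "K0 \<alpha> f t = K \<alpha> 0 t f t"
  unfolding K0_def by (intro tendsto_Lim K_tendsto_of_integrable assms) simp

lemma K0_part_exists_of_integrable:
  assumes "0 < t" and f: "set_integrable lebesgue {0<..<t} (K_integrand \<alpha> f t)"
  shows "K0_part_exists \<alpha> f t"
  unfolding K0_part_exists_def
  using K_tendsto_of_integrable[OF assms]
  by (auto intro!: exI set_integrable_subset[OF f])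

lemma K_integrand_uminus: "K_integrand \<alpha> (\<lambda>s. - f s) t = (\<lambda>\<tau>. - K_integrand \<alpha> f t \<tau>)"
  by (auto simp: K_integrand_def minus_divide_left)

lemma K_uminus: "K \<alpha> b c (\<lambda>s. - f s) t = - K \<alpha> b c f t"
  by (simp add: K_def K_integrand_uminus set_lebesgue_integral_def)

lemma J_uminus: "J \<alpha> (\<lambda>s. - f s) t = - J \<alpha> f t"
  by (simp add: J_def minus_divide_left)

text \<open>Taking positive parts is 1-Lipschitz, so the integrands for the positive and negative
  part are dominated by the integrand of \<open>f\<close> itself.\<close>

lemma K0_exists_of_integrable:
  assumes t: "0 < t" and f: "set_integrable lebesgue {0<..<t} (K_integrand \<alpha> f t)"
  shows "K0_exists \<alpha> f t"
proof -
  have part: "K0_part_exists \<alpha> (\<lambda>s. max (g s) 0) t"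
    if g: "set_integrable lebesgue {0<..<t} (K_integrand \<alpha> g t)" for g
  proof (rule K0_part_exists_of_integrable[OF t])
    have [measurable]: "(\<lambda>\<tau>. indicator {0<..<t} \<tau> *\<^sub>R K_integrand \<alpha> g t \<tau>) \<in> borel_measurable lebesgue"
      using g by (auto simp: set_integrable_def)
    have [measurable]: "(\<lambda>\<tau>::real. \<tau>) \<in> borel_measurable lebesgue"
      by (rule measurable_completion) simp
    \<comment> \<open>Measurability is known only for the integrand, not for \<open>g\<close>. The
      value of \<open>g\<close> at t - \<tau> is recovered by solving the integrand for it, which
      exhibits the new integrand as a measurable expression in the old one.\<close>
    have eq: "indicator {0<..<t} \<tau> *\<^sub>R K_integrand \<alpha> (\<lambda>s. max (g s) 0) t \<tau> =
      indicator {0<..<t} \<tau> * ((max (g t) 0 - max (g t - \<tau> powr (\<alpha> + 1) *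
         (indicator {0<..<t} \<tau> *\<^sub>R K_integrand \<alpha> g t \<tau>)) 0) / \<tau> powr (\<alpha> + 1))" for \<tau>
      by (auto simp: indicator_def K_integrand_def)
    have [measurable]: "set_borel_measurable lebesgue {0<..<t} (K_integrand \<alpha> (\<lambda>s. max (g s) 0) t)"
      unfolding set_borel_measurable_def eq by measurable
    show "set_integrable lebesgue {0<..<t} (K_integrand \<alpha> (\<lambda>s. max (g s) 0) t)"
    proof (rule set_integrable_bound[OF g])
      show "AE x in lebesgue. x \<in> {0<..<t} \<longrightarrow>
         norm (K_integrand \<alpha> (\<lambda>s. max (g s) 0) t x) \<le> norm (K_integrand \<alpha> g t x)"
        by (intro AE_I2) (auto simp: K_integrand_def intro!: divide_right_mono)
    qed fact
  qed
  have "set_integrable lebesgue {0<..<t} (K_integrand \<alpha> (\<lambda>s. - f s) t)"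
    using f by (simp add: K_integrand_uminus set_integrable_def)
  from part[OF f] part[OF this] show ?thesis
    by (simp add: K0_exists_def)
qed

lemma K0_exists_uminus: "K0_exists \<alpha> (\<lambda>s. - f s) t \<longleftrightarrow> K0_exists \<alpha> f t"
  by (auto simp: K0_exists_def)

text \<open>\<open>K0_exists\<close> speaks of the two parts of \<open>f\<close> separately.
  Subtracting their limits shows that the \<open>Lim\<close> in \<open>K0\<close> is a genuine
  limit.\<close>

lemma K_tendsto_K0_of_exists:
  assumes "0 < t" and "K0_exists \<alpha> f t"
  shows "((\<lambda>b. K \<alpha> b t f t) \<longlongrightarrow> K0 \<alpha> f t) (at_right 0)"
    and "b \<in> {0<..<t} \<Longrightarrow> set_integrable lebesgue {b<..<t} (K_integrand \<alpha> f t)"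
proof -
  let ?p = "\<lambda>s. max (f s) 0" and ?n = "\<lambda>s. max (- f s) 0"
  have split: "K_integrand \<alpha> f t = (\<lambda>\<tau>. K_integrand \<alpha> ?p t \<tau> - K_integrand \<alpha> ?n t \<tau>)"
    by (auto simp: K_integrand_def fun_eq_iff max_def simp flip: diff_divide_distrib)
  have int: "set_integrable lebesgue {b<..<t} (K_integrand \<alpha> ?p t)"
    "set_integrable lebesgue {b<..<t} (K_integrand \<alpha> ?n t)" if "b \<in> {0<..<t}" for b
    using assms that by (auto simp: K0_exists_def K0_part_exists_def)
  obtain l m where "((\<lambda>b. K \<alpha> b t ?p t) \<longlongrightarrow> l) (at_right 0)" "((\<lambda>b. K \<alpha> b t ?n t) \<longlongrightarrow> m) (at_right 0)"
    using assms by (auto simp: K0_exists_def K0_part_exists_def)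
  then have "((\<lambda>b. K \<alpha> b t ?p t - K \<alpha> b t ?n t) \<longlongrightarrow> l - m) (at_right 0)"
    by (rule tendsto_diff)
  moreover have "\<forall>\<^sub>F b in at_right 0. K \<alpha> b t ?p t - K \<alpha> b t ?n t = K \<alpha> b t f t"
  proof (rule eventually_at_rightI[OF _ \<open>0 < t\<close>])
    fix b assume "b \<in> {0<..<t}"
    then show "K \<alpha> b t ?p t - K \<alpha> b t ?n t = K \<alpha> b t f t"
      using int[of b] by (simp add: K_def split set_integral_diff right_diff_distrib)
  qed
  ultimately have "((\<lambda>b. K \<alpha> b t f t) \<longlongrightarrow> l - m) (at_right 0)"
    by (rule Lim_transform_eventually)
  then show "((\<lambda>b. K \<alpha> b t f t) \<longlongrightarrow> K0 \<alpha> f t) (at_right 0)"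
    unfolding K0_def by (metis tendsto_Lim trivial_limit_at_right_real)
  show "set_integrable lebesgue {b<..<t} (K_integrand \<alpha> f t)" if "b \<in> {0<..<t}"
    unfolding split using int[OF that] by (rule set_integral_diff)
qed

text \<open>The sign is moved through a limit that exists; the \<open>Lim\<close> of a divergent
  expression would be an unspecified number.\<close>

lemma K0_uminus:
  assumes "0 < t" and "K0_exists \<alpha> f t"
  shows "K0 \<alpha> (\<lambda>s. - f s) t = - K0 \<alpha> f t"
  using tendsto_minus[OF K_tendsto_K0_of_exists(1)[OF assms]]
  unfolding K0_def[of \<alpha> "\<lambda>s. - f s"] K_uminus by (intro tendsto_Lim) auto

text \<open>The backward difference quotient, continued by \<open>D\<close> at \<tau> = 0, is
  continuous on a compact interval and hence bounded. The integrand is this quotient times \<tau> to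
  the power -\<alpha>, which is integrable at 0 because \<alpha> < 1.\<close>

lemma K_integrand_integrable:
  assumes t: "0 < t" and \<alpha>: "\<alpha> < 1"
    and cont: "continuous_on {0..t} g" and deriv: "(g has_real_derivative D) (at t)"
  shows "set_integrable lebesgue {0<..<t} (K_integrand \<alpha> g t)"
proof -
  define q where "q = (\<lambda>\<tau>. if \<tau> = 0 then D else (g t - g (t - \<tau>)) / \<tau>)"
  have "continuous_on {0..t} q"
    unfolding continuous_on_def
  proof
    fix \<tau> assume \<tau>: "\<tau> \<in> {0..t}"
    show "(q \<longlongrightarrow> q \<tau>) (at \<tau> within {0..t})"
    proof (cases "\<tau> = 0")
      case True
      have "((\<lambda>h. (g (t + h) - g t) / h) \<longlongrightarrow> D) (at 0)"
        using deriv by (simp add: DERIV_def)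
      moreover have "filterlim (\<lambda>\<tau>::real. - \<tau>) (at 0) (at 0)"
        using filtermap_at_minus[of "0::real"] by (simp add: filterlim_def)
      ultimately have "((\<lambda>\<tau>. (g (t + - \<tau>) - g t) / - \<tau>) \<longlongrightarrow> D) (at 0)"
        by (rule filterlim_compose)
      then have "(q \<longlongrightarrow> D) (at 0)"
      proof (rule Lim_transform_eventually)
        show "\<forall>\<^sub>F \<tau> in at 0. (g (t + - \<tau>) - g t) / - \<tau> = q \<tau>"
          by (auto simp: eventually_at_filter q_def divide_simps)
      qed
      then show ?thesis
        using True by (auto simp: q_def intro: tendsto_within_subset)
    next
      case False
      have "continuous_on ({0..t} - {0}) (\<lambda>\<tau>. (g t - g (t - \<tau>)) / \<tau>)"
        by (intro continuous_intros continuous_on_compose2[OF cont]) auto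
      then have "((\<lambda>\<tau>. (g t - g (t - \<tau>)) / \<tau>) \<longlongrightarrow> q \<tau>) (at \<tau> within ({0..t} - {0}))"
        using False \<tau> by (auto simp: continuous_on_def q_def)
      moreover have "at \<tau> within ({0..t} - {0}) = at \<tau> within {0..t}"
        by (rule at_within_nhd[of _ "- {0}"]) (use False in auto)
      ultimately have "((\<lambda>\<tau>. (g t - g (t - \<tau>)) / \<tau>) \<longlongrightarrow> q \<tau>) (at \<tau> within {0..t})"
        by simp
      then show ?thesis
      proof (rule Lim_transform_eventually)
        show "\<forall>\<^sub>F x in at \<tau> within {0..t}. (g t - g (t - x)) / x = q x"
          using False by (auto simp: q_def eventually_at_topological intro!: exI[of _ "- {0}"])
      qed
    qed
  qed
  then have "bounded (q ` {0..t})"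
    by (intro compact_imp_bounded compact_continuous_image) auto
  then obtain B where B: "\<And>\<tau>. \<tau> \<in> {0..t} \<Longrightarrow> \<bar>q \<tau>\<bar> \<le> B"
    by (auto simp: bounded_iff simp del: atLeastAtMost_iff)
  have eq: "K_integrand \<alpha> g t \<tau> = q \<tau> * \<tau> powr - \<alpha>" if "\<tau> \<in> {0<..<t}" for \<tau>
    using that by (auto simp: K_integrand_def q_def powr_add powr_minus divide_simps)
  have "(\<lambda>\<tau>. \<tau> powr - \<alpha>) absolutely_integrable_on {0<..t}"
    using t \<alpha> by (intro nonnegative_absolutely_integrable_1 integrable_on_powr_from_0') auto
  then have "set_integrable lebesgue {0<..<t} (\<lambda>\<tau>. \<tau> powr - \<alpha>)"
    by (rule set_integrable_subset) auto
  then have "set_integrable lebesgue {0<..<t} (\<lambda>\<tau>. B * \<tau> powr - \<alpha>)"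
    by simp
  then show ?thesis
  proof (rule set_integrable_bound)
    have "continuous_on {0<..<t} (K_integrand \<alpha> g t)"
      unfolding K_integrand_def
      by (intro continuous_intros continuous_on_compose2[OF cont]) auto
    then show "set_borel_measurable lebesgue {0<..<t} (K_integrand \<alpha> g t)"
      unfolding set_borel_measurable_def
      by (intro measurable_completion)
         (simp add: borel_measurable_continuous_on_indicator del: real_scaleR_def)
    show "AE x in lebesgue. x \<in> {0<..<t} \<longrightarrow> norm (K_integrand \<alpha> g t x) \<le> norm (B * x powr - \<alpha>)"
    proof (intro AE_I2 impI)
      fix x assume x: "x \<in> {0<..<t}"
      then have "\<bar>q x\<bar> * x powr - \<alpha> \<le> \<bar>B\<bar> * x powr - \<alpha>"
        using B[of x] by (intro mult_right_mono) auto
      then show "norm (K_integrand \<alpha> g t x) \<le> norm (B * x powr - \<alpha>)"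
        by (simp add: eq[OF x] abs_mult)
    qed
  qed
qed

section \<open>Comparison and passage to the limit for J + K\<close>

lemma J_mono:
  assumes "0 < t" and "\<alpha> < 1" and "g t - g 0 \<le> f t - f 0"
  shows "J \<alpha> g t \<le> J \<alpha> f t"
  using assms unfolding J_def by (intro divide_right_mono) auto

text \<open>The comparison is made on (b,t) with b > 0 and then passed to the limit, since
  \<open>K0_exists\<close> gives integrability for \<open>f\<close> only away from the
  singularity.\<close>

lemma JK0_mono:
  assumes t: "0 < t" and \<alpha>: "0 < \<alpha>" "\<alpha> < 1"
    and g: "set_integrable lebesgue {0<..<t} (K_integrand \<alpha> g t)" and f: "K0_exists \<alpha> f t"
    and le: "\<And>s. s \<in> {0..t} \<Longrightarrow> g t - g s \<le> f t - f s"
  shows "J \<alpha> g t + K0 \<alpha> g t \<le> J \<alpha> f t + K0 \<alpha> f t"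
proof (rule add_mono)
  show "J \<alpha> g t \<le> J \<alpha> f t" using J_mono[OF t \<alpha>(2)] le[of 0] t by simp
  show "K0 \<alpha> g t \<le> K0 \<alpha> f t"
  proof (rule tendsto_le)
    show "((\<lambda>b. K \<alpha> b t f t) \<longlongrightarrow> K0 \<alpha> f t) (at_right 0)"
      by (rule K_tendsto_K0_of_exists[OF t f])
    show "((\<lambda>b. K \<alpha> b t g t) \<longlongrightarrow> K0 \<alpha> g t) (at_right 0)"
      by (rule K_tendsto_K0_of_exists[OF t K0_exists_of_integrable[OF t g]])
    show "\<forall>\<^sub>F b in at_right 0. K \<alpha> b t g t \<le> K \<alpha> b t f t"
    proof (rule eventually_at_rightI[OF _ t])
      fix b assume b: "b \<in> {0<..<t}"
      have "set_lebesgue_integral lebesgue {b<..<t} (K_integrand \<alpha> g t)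
          \<le> set_lebesgue_integral lebesgue {b<..<t} (K_integrand \<alpha> f t)"
      proof (rule set_integral_mono)
        show "set_integrable lebesgue {b<..<t} (K_integrand \<alpha> g t)"
          by (rule set_integrable_subset[OF g]) (use b in auto)
        show "set_integrable lebesgue {b<..<t} (K_integrand \<alpha> f t)"
          by (rule K_tendsto_K0_of_exists(2)[OF t f b])
        show "K_integrand \<alpha> g t x \<le> K_integrand \<alpha> f t x" if "x \<in> {b<..<t}" for x
          unfolding K_integrand_def using that b by (intro divide_right_mono le) auto
      qed
      then show "K \<alpha> b t g t \<le> K \<alpha> b t f t"
        unfolding K_def using \<alpha> by (intro mult_left_mono) auto
    qed
  qed simp
qed

text \<open>Fatou's lemma for \<open>k (g n) - k G\<close>, which is nonnegative by
  \<open>dom\<close>. The common bound \<open>C\<close> keeps the integrals bounded above, so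
  integrability of the limit integrand comes out as a conclusion.\<close>

lemma K0_Fatou:
  assumes t: "0 < t" and \<alpha>: "0 < \<alpha>" "\<alpha> < 1"
    and g: "\<And>n. set_integrable lebesgue {0<..<t} (K_integrand \<alpha> (g n) t)"
    and G: "set_integrable lebesgue {0<..<t} (K_integrand \<alpha> G t)"
    and dom: "\<And>n s. s \<in> {0..<t} \<Longrightarrow> G t - G s \<le> g n t - g n s"
    and lim: "\<And>s. s \<in> {0..<t} \<Longrightarrow> (\<lambda>n. g n t - g n s) \<longlonglongrightarrow> f t - f s"
    and C: "\<And>n. J \<alpha> (g n) t + K0 \<alpha> (g n) t \<le> C"
  shows "set_integrable lebesgue {0<..<t} (K_integrand \<alpha> f t)"
    and "J \<alpha> f t + K0 \<alpha> f t \<le> C"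
proof -
  define c where "c = \<alpha> / Gamma (1 - \<alpha>)"
  have c: "c > 0" using \<alpha> by (simp add: c_def)
  define I where "I = (\<lambda>h. set_lebesgue_integral lebesgue {0<..<t} (K_integrand \<alpha> h t))"
  define k where "k = (\<lambda>h \<tau>. indicator {0<..<t} \<tau> * K_integrand \<alpha> h t \<tau>)"
  have K0: "K0 \<alpha> h t = c * I h" if "set_integrable lebesgue {0<..<t} (K_integrand \<alpha> h t)" for h
    using K0_eq_K[OF t that] by (simp add: K_def I_def c_def)
  have int: "integrable lebesgue (k h) \<longleftrightarrow> set_integrable lebesgue {0<..<t} (K_integrand \<alpha> h t)" for h
    by (simp add: k_def set_integrable_def)
  have I: "I h = integral\<^sup>L lebesgue (k h)" for h
    by (simp add: I_def k_def set_lebesgue_integral_def)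
  have gi: "integrable lebesgue (k (g n))" for n using g int by blast
  have Gi: "integrable lebesgue (k G)" using G int by blast
  \<comment> \<open>The bound on J + K0 solved for the integral. It depends on n because the J-term
    does.\<close>
  define B where "B = (\<lambda>n. (C - J \<alpha> (g n) t) / c)"
  have IB: "I (g n) \<le> B n" for n
    using C[of n] c by (simp add: K0[OF g] B_def field_simps)
  \<comment> \<open>The case s = 0 of \<open>lim\<close> gives the convergence of the
    J-term.\<close>
  have Jlim: "(\<lambda>n. J \<alpha> (g n) t) \<longlonglongrightarrow> J \<alpha> f t"
    unfolding J_def by (intro tendsto_divide lim tendsto_const) (use t \<alpha> in \<open>auto simp: Gamma_eq_zero_iff\<close>)
  have Blim: "B \<longlonglongrightarrow> (C - J \<alpha> f t) / c"
    unfolding B_def by (intro tendsto_intros Jlim) (use c in auto)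
  have klim: "(\<lambda>n. k (g n) \<tau>) \<longlonglongrightarrow> k f \<tau>" for \<tau>
  proof (cases "\<tau> \<in> {0<..<t}")
    case True
    then have "(\<lambda>n. (g n t - g n (t - \<tau>)) / \<tau> powr (\<alpha> + 1)) \<longlonglongrightarrow> (f t - f (t - \<tau>)) / \<tau> powr (\<alpha> + 1)"
      by (intro tendsto_divide lim tendsto_const) auto
    then show ?thesis using True by (simp add: k_def K_integrand_def)
  qed (simp add: k_def)
  have kG: "k G \<tau> \<le> k (g n) \<tau>" for n \<tau>
    by (auto simp: k_def K_integrand_def indicator_def intro!: divide_right_mono dom)
  have kGf: "k G \<tau> \<le> k f \<tau>" for \<tau>
    by (rule LIMSEQ_le_const[OF klim]) (use kG in auto)
  have meas: "k f \<in> borel_measurable lebesgue"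
    by (rule borel_measurable_LIMSEQ_real[OF klim]) (use gi in auto)
  have "(\<integral>\<^sup>+\<tau>. ennreal (k f \<tau> - k G \<tau>) \<partial>lebesgue)
      = (\<integral>\<^sup>+\<tau>. liminf (\<lambda>n. ennreal (k (g n) \<tau> - k G \<tau>)) \<partial>lebesgue)"
  proof (rule nn_integral_cong)
    fix \<tau>
    have "(\<lambda>n. ennreal (k (g n) \<tau> - k G \<tau>)) \<longlonglongrightarrow> ennreal (k f \<tau> - k G \<tau>)"
      by (intro tendsto_intros klim)
    then show "ennreal (k f \<tau> - k G \<tau>) = liminf (\<lambda>n. ennreal (k (g n) \<tau> - k G \<tau>))"
      by (intro lim_imp_Liminf[symmetric]) auto
  qed
  also have "\<dots> \<le> liminf (\<lambda>n. \<integral>\<^sup>+\<tau>. ennreal (k (g n) \<tau> - k G \<tau>) \<partial>lebesgue)"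
    by (rule nn_integral_liminf) (use gi Gi in auto)
  also have "\<dots> = liminf (\<lambda>n. ennreal (I (g n) - I G))"
  proof -
    have "(\<integral>\<^sup>+\<tau>. ennreal (k (g n) \<tau> - k G \<tau>) \<partial>lebesgue) = ennreal (I (g n) - I G)" for n
      unfolding I using kG by (subst nn_integral_eq_integral) (auto simp: gi Gi)
    then show ?thesis by simp
  qed
  also have "\<dots> \<le> liminf (\<lambda>n. ennreal (B n - I G))"
    by (intro Liminf_mono always_eventually allI ennreal_leI diff_mono IB order_refl)
  also have "\<dots> = ennreal ((C - J \<alpha> f t) / c - I G)"
    by (intro lim_imp_Liminf tendsto_intros Blim) auto
  finally have fin: "(\<integral>\<^sup>+\<tau>. ennreal (k f \<tau> - k G \<tau>) \<partial>lebesgue) \<le> ennreal ((C - J \<alpha> f t) / c - I G)" .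
  have fG: "integrable lebesgue (\<lambda>\<tau>. k f \<tau> - k G \<tau>)"
  proof (rule integrableI_nonneg)
    show "(\<lambda>\<tau>. k f \<tau> - k G \<tau>) \<in> borel_measurable lebesgue"
      using meas Gi by auto
  qed (use kGf fin in \<open>auto intro: le_less_trans\<close>)
  then have "integrable lebesgue (\<lambda>\<tau>. (k f \<tau> - k G \<tau>) + k G \<tau>)"
    using Gi by (rule Bochner_Integration.integrable_add)
  then have fi: "integrable lebesgue (k f)" by simp
  then show int_f: "set_integrable lebesgue {0<..<t} (K_integrand \<alpha> f t)" by (simp add: int)
  \<comment> \<open>\<open>ennreal\<close> sends negative reals to 0, so the estimate
    \<open>fin\<close> can be read in the reals only after its right-hand side is seen to be
    nonnegative.\<close>
  have nonneg: "0 \<le> (C - J \<alpha> f t) / c - I G"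
  proof (rule LIMSEQ_le_const)
    show "(\<lambda>n. B n - I G) \<longlonglongrightarrow> (C - J \<alpha> f t) / c - I G"
      by (intro tendsto_intros Blim)
    have "I G \<le> I (g n)" for n
      unfolding I by (intro integral_mono gi Gi kG)
    then show "\<exists>N. \<forall>n\<ge>N. 0 \<le> B n - I G"
      using IB order_trans by (metis diff_ge_0_iff_ge)
  qed
  have "ennreal (I f - I G) \<le> ennreal ((C - J \<alpha> f t) / c - I G)"
    using fin kGf unfolding I by (subst (asm) nn_integral_eq_integral[OF fG]) (auto simp: fi Gi)
  then have "I f \<le> (C - J \<alpha> f t) / c"
    using nonneg by (simp add: ennreal_le_iff)
  then show "J \<alpha> f t + K0 \<alpha> f t \<le> C"
    using c by (simp add: K0[OF int_f] field_simps)
qed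

section \<open>Approximation by test functions\<close>

lemma C12_continuous_on:
  assumes "open \<Omega>" and "a < T" and "C12 a T \<Omega> \<phi>"
  shows "continuous_on ({a<..T} \<times> \<Omega>) \<phi>"
proof -
  obtain S d g H where "{a<..T} \<times> \<Omega> \<subseteq> S" "C12_witness S \<phi> d g H"
    using iffD1[OF C12_iff_witness[OF assms(1,2)] assms(3)] by blast
  then show ?thesis
    by (auto simp: C12_witness_def intro: continuous_on_subset)
qed

text \<open>The linear term lets one statement cover the test functions (c = 0) and the lower
  barrier of the Fatou argument (c = -1). At t = T the two-sided derivative exists because the
  regularity set is open and contains the point.\<close>

lemma C12_K_integrand_integrable:
  assumes \<Omega>: "open \<Omega>" and a: "0 \<le> a" "a < T" and "\<alpha> < 1" and \<phi>: "C12 a T \<Omega> \<phi>"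
    and cont: "continuous_on ({0..T} \<times> \<Omega>) \<phi>" and t: "t \<in> {a<..T}" and x: "x \<in> \<Omega>"
  shows "set_integrable lebesgue {0<..<t} (K_integrand \<alpha> (\<lambda>s. \<phi> (s, x) + c * s) t)"
proof -
  obtain S d g H where "{a<..T} \<times> \<Omega> \<subseteq> S" "C12_witness S \<phi> d g H"
    using iffD1[OF C12_iff_witness[OF \<Omega> a(2)] \<phi>] by blast
  moreover from this have "(t, x) \<in> S" using t x by auto
  ultimately have "((\<lambda>s. \<phi> (s, x)) has_real_derivative d (t, x)) (at t)"
    by (simp add: C12_witness_def)
  then have D: "((\<lambda>s. \<phi> (s, x) + c * s) has_real_derivative d (t, x) + c) (at t)"
    by (auto intro!: derivative_eq_intros)
  have "continuous_on {0..t} (\<lambda>s. \<phi> (s, x))"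
    using t x a by (intro continuous_on_compose2[OF cont] continuous_intros) auto
  then have "continuous_on {0..t} (\<lambda>s. \<phi> (s, x) + c * s)"
    by (intro continuous_intros)
  from K_integrand_integrable[OF _ \<open>\<alpha> < 1\<close> this D] show ?thesis
    using t a by simp
qed

lemma usc_on_diff_continuous:
  assumes v: "usc_on A v" and \<phi>: "continuous_on A \<phi>"
  shows "usc_on A (\<lambda>p. v p - \<phi> p)"
  unfolding usc_on_def
proof (intro ballI allI impI)
  fix p and e :: real assume p: "p \<in> A" and e: "e > 0"
  obtain d where d: "d > 0" "\<And>q. q \<in> A \<Longrightarrow> dist q p < d \<Longrightarrow> v q < v p + e / 2"
    using v p e unfolding usc_on_def by (meson half_gt_zero)
  obtain d' where d': "d' > 0" "\<And>q. q \<in> A \<Longrightarrow> dist q p < d' \<Longrightarrow> dist (\<phi> q) (\<phi> p) < e / 2"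
    using \<phi> p e unfolding continuous_on_iff by (meson half_gt_zero)
  show "\<exists>\<delta>>0. \<forall>q\<in>A. dist q p < \<delta> \<longrightarrow> v q - \<phi> q < v p - \<phi> p + e"
  proof (intro exI[of _ "min d d'"] conjI ballI impI)
    fix q assume q: "q \<in> A" "dist q p < min d d'"
    then have "v q < v p + e / 2" "dist (\<phi> q) (\<phi> p) < e / 2"
      using d(2) d'(2) by auto
    then show "v q - \<phi> q < v p - \<phi> p + e"
      by (auto simp: dist_real_def abs_if split: if_splits)
  qed (use d d' in auto)
qed

text \<open>\<phi> is uncontrolled as time decreases to \<open>a\<close>. Since v - \<kappa> lies
  below \<phi> for times after \<open>a\<close> and below \<open>M\<close> at all times, it lies
  below every convex combination of the two; the weight of \<phi> is switched off before time
  \<open>a\<close> is reached.\<close>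

lemma C12_majorant_extension:
  fixes v :: "real \<times> (real ^ 'd) \<Rightarrow> real"
  assumes \<Omega>: "open \<Omega>" and a: "0 \<le> a" "a < T" and t: "t \<in> {a<..T}"
    and v: "usc_on ({0..T} \<times> \<Omega>) v" and \<phi>: "C12 a T \<Omega> \<phi>"
    and le: "\<And>p. p \<in> {a<..T} \<times> \<Omega> \<Longrightarrow> v p - \<phi> p \<le> \<kappa>"
  obtains \<Phi> where "C12 a T \<Omega> \<Phi>" "continuous_on ({0..T} \<times> \<Omega>) \<Phi>"
    "\<And>p. p \<in> {0..T} \<times> \<Omega> \<Longrightarrow> v p - \<Phi> p \<le> \<kappa>" "\<And>y. \<Phi> (t, y) = \<phi> (t, y)"
proof -
  \<comment> \<open>The points dividing the interval from a to t into thirds.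
    \<open>t\<^sub>1 > a\<close> makes the product with \<phi> vanish near and before time a, and
    \<open>t\<^sub>2 < t\<close> leaves the slice at time t unchanged.\<close>
  define t\<^sub>1 t\<^sub>2 where "t\<^sub>1 = (2 * a + t) / 3" and "t\<^sub>2 = (a + 2 * t) / 3"
  have t12: "a < t\<^sub>1" "t\<^sub>1 < t\<^sub>2" "t\<^sub>2 < t" using t by (auto simp: t\<^sub>1_def t\<^sub>2_def)
  obtain c c' where c: "\<And>t. (c has_real_derivative c' t) (at t)" "continuous_on UNIV c'"
    "\<And>t. 0 \<le> c t" "\<And>t. c t \<le> 1" "\<And>t. t \<le> t\<^sub>1 \<Longrightarrow> c t = 0" "\<And>t. t\<^sub>2 \<le> t \<Longrightarrow> c t = 1"
    using smooth_step[OF t12(2)] by blast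
  have cc: "continuous_on UNIV c"
    using c(1) by (meson DERIV_continuous_on has_field_derivative_at_within)
  have "\<exists>B. \<forall>x\<in>K. \<forall>s\<in>{0..T}. v (s, x) - \<kappa> \<le> B" if K: "compact K" "K \<subseteq> \<Omega>" for K
  proof -
    have "compact ({0..T} \<times> K)" "{0..T} \<times> K \<subseteq> {0..T} \<times> \<Omega>"
      using K by (auto intro: compact_Times)
    then obtain B where "\<And>p. p \<in> {0..T} \<times> K \<Longrightarrow> v p \<le> B"
      using usc_on_bounded_above[OF v] by metis
    then show ?thesis by (intro exI[of _ "B - \<kappa>"]) auto
  qed
  from C2_dominating[OF \<Omega> this] obtain M
    where M: "C12_on (UNIV \<times> \<Omega>) (\<lambda>p. M (snd p))" "\<And>x s. x \<in> \<Omega> \<Longrightarrow> s \<in> {0..T} \<Longrightarrow> v (s, x) - \<kappa> \<le> M x"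
    by metis
  define \<Phi> where "\<Phi> = (\<lambda>p. c (fst p) * \<phi> p + (1 - c (fst p)) * M (snd p))"
  obtain S d g H where S: "open S" "{a<..T} \<times> \<Omega> \<subseteq> S" "S \<subseteq> UNIV \<times> \<Omega>" "C12_witness S \<phi> d g H"
    using iffD1[OF C12_iff_witness[OF \<Omega> a(2)] \<phi>] by blast
  have "C12_on S (\<lambda>p. M (snd p))"
    using M(1) S(3) unfolding C12_on_def by (blast intro: continuous_on_subset)
  then obtain d' g' H' where M': "C12_witness S (\<lambda>p. M (snd p)) d' g' H'"
    using C12_on_iff_witness[OF S(1)] by blast
  have c1: "((\<lambda>t. 1 - c t) has_real_derivative - c' t) (at t)" for t
    by (auto intro!: derivative_eq_intros c)
  have c1': "continuous_on UNIV (\<lambda>t. - c' t)" by (intro continuous_intros c)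
  show ?thesis
  proof (rule that)
    show "C12 a T \<Omega> \<Phi>"
      unfolding C12_iff_witness[OF \<Omega> a(2)] \<Phi>_def
      using S(1-3) C12_witness_add[OF C12_witness_time_mult[OF S(4) c(1,2)] C12_witness_time_mult[OF M' c1 c1']]
      by blast
    show "continuous_on ({0..T} \<times> \<Omega>) \<Phi>"
    proof -
      let ?D = "{0..T} \<times> \<Omega>"
      have cM: "continuous_on ?D (\<lambda>p. M (snd p))"
        using M(1) by (auto simp: C12_on_def intro: continuous_on_subset)
      have ccD: "continuous_on ?D (\<lambda>p. c (fst p))"
        by (intro continuous_on_compose2[OF cc] continuous_intros) auto
      \<comment> \<open>The pieces \<open>late\<close> and \<open>early\<close> are relatively open
        and cover the domain because \<open>a < t\<^sub>1\<close>, so continuity can be checked on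
        each.\<close>
      have late: "continuous_on (?D \<inter> {a<..} \<times> UNIV) (\<lambda>p. c (fst p) * \<phi> p)"
        by (intro continuous_on_mult continuous_on_subset[OF ccD] continuous_on_subset[OF C12_continuous_on[OF \<Omega> a(2) \<phi>]]) auto
      have early: "continuous_on (?D \<inter> {..<t\<^sub>1} \<times> UNIV) (\<lambda>p. c (fst p) * \<phi> p)"
        by (rule continuous_on_eq[of _ "\<lambda>p. 0"]) (auto simp: c(5))
      have "?D = (?D \<inter> {a<..} \<times> UNIV) \<union> (?D \<inter> {..<t\<^sub>1} \<times> UNIV)"
        using t12(1) by auto
      moreover have "continuous_on ((?D \<inter> {a<..} \<times> UNIV) \<union> (?D \<inter> {..<t\<^sub>1} \<times> UNIV)) (\<lambda>p. c (fst p) * \<phi> p)"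
      proof (rule continuous_on_Un_local_open[OF _ _ late early])
        have rel: "openin (top_of_set ((?D \<inter> {a<..} \<times> UNIV) \<union> (?D \<inter> {..<t\<^sub>1} \<times> UNIV))) (?D \<inter> U \<times> UNIV)"
          if "open U" for U :: "real set"
          unfolding calculation[symmetric] by (intro openin_open_Int open_Times that open_UNIV)
        show "openin (top_of_set ((?D \<inter> {a<..} \<times> UNIV) \<union> (?D \<inter> {..<t\<^sub>1} \<times> UNIV))) (?D \<inter> {a<..} \<times> UNIV)"
          "openin (top_of_set ((?D \<inter> {a<..} \<times> UNIV) \<union> (?D \<inter> {..<t\<^sub>1} \<times> UNIV))) (?D \<inter> {..<t\<^sub>1} \<times> UNIV)"
          by (rule rel, simp)+
      qed
      ultimately have "continuous_on ?D (\<lambda>p. c (fst p) * \<phi> p)" by simp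
      then show ?thesis
        unfolding \<Phi>_def
        by (rule continuous_on_add) (intro continuous_on_mult continuous_on_diff continuous_on_const ccD cM)
    qed
    show "v p - \<Phi> p \<le> \<kappa>" if p: "p \<in> {0..T} \<times> \<Omega>" for p
    proof -
      have "c (fst p) * (v p - \<kappa>) \<le> c (fst p) * \<phi> p"
      proof (cases "fst p > a")
        case True
        then have "p \<in> {a<..T} \<times> \<Omega>" using p by auto
        from le[OF this] show ?thesis by (intro mult_left_mono c(3)) simp
      next
        \<comment> \<open>Here the weight is 0, so the arbitrary values of \<phi> at times up to a
          do not enter.\<close>
        case False
        then show ?thesis using c(5)[of "fst p"] t12 by simp
      qed
      moreover have "(1 - c (fst p)) * (v p - \<kappa>) \<le> (1 - c (fst p)) * M (snd p)"
        using M(2)[of "snd p" "fst p"] p c(4)[of "fst p"] by (intro mult_left_mono) auto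
      ultimately have "v p - \<kappa> \<le> \<Phi> p" by (simp add: \<Phi>_def algebra_simps)
      then show ?thesis by simp
    qed
    show "\<Phi> (t, y) = \<phi> (t, y)" for y using c(6)[of t] t12 by (simp add: \<Phi>_def)
  qed
qed

text \<open>The spatial penalty is centred at the fixed point x, so \<open>h N\<close> is a function
  of time only. Using p itself as competitor gives the majorant property; moving s changes each
  competitor by at most N times the shift, whence continuity. For large N competitors far from (s,
  x) are too expensive, and upper semicontinuity controls the near ones.\<close>

lemma sup_convolution:
  fixes z :: "real \<times> 'a::real_normed_vector \<Rightarrow> real" and x :: 'a
  assumes z: "usc_on A z" and neg: "\<And>p. p \<in> A \<Longrightarrow> z p \<le> 0" and ne: "A \<noteq> {}"
    and h_eq: "\<And>N s. h N s = (SUP p\<in>A. z p - N * (\<bar>s - fst p\<bar> + (norm (snd p - x))\<^sup>2))"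
  shows "\<And>N p. N \<ge> 0 \<Longrightarrow> p \<in> A \<Longrightarrow> z p \<le> h N (fst p) + N * (norm (snd p - x))\<^sup>2"
    and "\<And>N s. N \<ge> 0 \<Longrightarrow> h N s \<le> 0"
    and "\<And>N. N \<ge> 0 \<Longrightarrow> continuous_on UNIV (h N)"
    and "\<And>s. (s, x) \<in> A \<Longrightarrow> ((\<lambda>N. h N s) \<longlongrightarrow> z (s, x)) at_top"
proof -
  have term_neg: "z p - N * (\<bar>s - fst p\<bar> + (norm (snd p - x))\<^sup>2) \<le> 0" if "p \<in> A" "N \<ge> 0" for p N s
  proof -
    have "0 \<le> N * (\<bar>s - fst p\<bar> + (norm (snd p - x))\<^sup>2)" using that by simp
    then show ?thesis using neg[OF that(1)] by linarith
  qed
  then have bdd: "bdd_above ((\<lambda>p. z p - N * (\<bar>s - fst p\<bar> + (norm (snd p - x))\<^sup>2)) ` A)" if "N \<ge> 0" for N s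
    using that by (auto intro!: bdd_aboveI[of _ 0])
  have upper: "z p - N * (\<bar>s - fst p\<bar> + (norm (snd p - x))\<^sup>2) \<le> h N s" if "p \<in> A" "N \<ge> 0" for p N s
    unfolding h_eq by (rule cSUP_upper[OF that(1) bdd[OF that(2)]])
  show "z p \<le> h N (fst p) + N * (norm (snd p - x))\<^sup>2" if "N \<ge> 0" "p \<in> A" for N p
    using upper[OF that(2,1), of "fst p"] by simp
  show "h N s \<le> 0" if "N \<ge> 0" for N s
    unfolding h_eq using ne term_neg that by (intro cSUP_least) auto
  have Lip: "h N s \<le> h N s' + N * \<bar>s - s'\<bar>" if N: "N \<ge> 0" for N s s'
    unfolding h_eq[of N s]
  proof (rule cSUP_least[OF ne])
    fix p assume p: "p \<in> A"
    have "N * \<bar>s' - fst p\<bar> \<le> N * (\<bar>s - fst p\<bar> + \<bar>s - s'\<bar>)"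
      using N by (intro mult_left_mono) auto
    then show "z p - N * (\<bar>s - fst p\<bar> + (norm (snd p - x))\<^sup>2) \<le> h N s' + N * \<bar>s - s'\<bar>"
      using upper[OF p N, of s'] by (simp add: algebra_simps)
  qed
  show "continuous_on UNIV (h N)" if N: "N \<ge> 0" for N
  proof (rule lipschitz_on_continuous_on[where L = N])
    have "dist (h N s) (h N s') \<le> N * dist s s'" for s s'
      using Lip[OF N, of s s'] Lip[OF N, of s' s] by (simp add: dist_real_def abs_minus_commute)
    then show "N-lipschitz_on UNIV (h N)" using N by (intro lipschitz_onI)
  qed
  show "((\<lambda>N. h N s) \<longlongrightarrow> z (s, x)) at_top" if sx: "(s, x) \<in> A" for s
  proof (rule order_tendstoI)
    fix b assume b: "b < z (s, x)"
    show "\<forall>\<^sub>F N in at_top. b < h N s"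
      using eventually_ge_at_top[of 0]
    proof eventually_elim
      case (elim N)
      then show ?case using upper[OF sx, of N s] b by simp
    qed
  next
    fix b assume b: "z (s, x) < b"
    define e where "e = (b - z (s, x)) / 2"
    have e: "e > 0" using b by (simp add: e_def)
    obtain \<delta> where \<delta>: "\<delta> > 0" "\<And>q. q \<in> A \<Longrightarrow> dist q (s, x) < \<delta> \<Longrightarrow> z q < z (s, x) + e"
      using z sx e unfolding usc_on_def by meson
    \<comment> \<open>At distance at least \<delta> from (s, x), either the time gap or the space
      gap is at least \<delta>/2. As the penalty is linear in the first and quadratic in the second,
      it is at least N * \<mu>.\<close>
    define \<mu> where "\<mu> = min (\<delta> / 2) ((\<delta> / 2)\<^sup>2)"
    have \<mu>: "\<mu> > 0" using \<delta>(1) by (simp add: \<mu>_def)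
    show "\<forall>\<^sub>F N in at_top. h N s < b"
      \<comment> \<open>From this threshold on, N * \<mu> is at least - z (s, x). As z is
        nonpositive, a far competitor then has value at most z (s, x).\<close>
      using eventually_ge_at_top[of "max 0 (- z (s, x) / \<mu>)"]
    proof eventually_elim
      case (elim N)
      then have N: "N \<ge> 0" "- z (s, x) \<le> N * \<mu>" using \<mu> by (auto simp: divide_simps)
      have "h N s \<le> z (s, x) + e"
        unfolding h_eq
      proof (rule cSUP_least[OF ne])
        fix p assume p: "p \<in> A"
        let ?r = "\<bar>s - fst p\<bar> + (norm (snd p - x))\<^sup>2"
        show "z p - N * ?r \<le> z (s, x) + e"
        proof (cases "dist p (s, x) < \<delta>")
          case True
          have "0 \<le> N * ?r" using N by simp
          then show ?thesis using \<delta>(2)[OF p True] by linarith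
        next
          case False
          have "dist p (s, x) \<le> \<bar>s - fst p\<bar> + norm (snd p - x)"
            using sqrt_sum_squares_le_sum_abs[of "dist (fst p) s" "dist (snd p) x"]
            by (cases p) (simp add: dist_Pair_Pair dist_real_def dist_norm[of _ x] abs_minus_commute)
          then have "\<delta> / 2 \<le> \<bar>s - fst p\<bar> \<or> \<delta> / 2 \<le> norm (snd p - x)"
            using False by linarith
          then have "\<mu> \<le> ?r"
          proof
            assume "\<delta> / 2 \<le> norm (snd p - x)"
            then have "(\<delta> / 2)\<^sup>2 \<le> (norm (snd p - x))\<^sup>2"
              using \<delta>(1) by (intro power_mono) auto
            then show ?thesis by (auto simp: \<mu>_def)
          qed (auto simp: \<mu>_def min_def intro: add_increasing2)
          then have "N * \<mu> \<le> N * ?r" using N by (intro mult_left_mono)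
          then show ?thesis using N neg[OF p] e by linarith
        qed
      qed
      also have "\<dots> < b" using b by (simp add: e_def field_simps)
      finally show ?case .
    qed
  qed
qed

text \<open>The cutoff preserves the majorant property because z is both nonpositive and below the
  correction \<open>w n\<close>, hence below any fraction of it. The bound by \<Phi> + (t - s),
  uniform in n, is what will supply the lower barrier for Fatou's lemma near the
  singularity.\<close>

lemma C12_approximating_majorants:
  fixes v :: "real \<times> (real ^ 'd) \<Rightarrow> real"
  assumes \<Omega>: "open \<Omega>" and a: "0 \<le> a" "a < T" and t: "t \<in> {a<..T}" and x: "x \<in> \<Omega>"
    and v: "usc_on ({0..T} \<times> \<Omega>) v" and \<Phi>: "C12 a T \<Omega> \<Phi>" "continuous_on ({0..T} \<times> \<Omega>) \<Phi>"
    and le: "\<And>p. p \<in> {0..T} \<times> \<Omega> \<Longrightarrow> v p - \<Phi> p \<le> \<kappa>"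
  obtains \<psi> :: "nat \<Rightarrow> real \<times> (real ^ 'd) \<Rightarrow> real" where
    "\<And>n. C12 a T \<Omega> (\<psi> n)" "\<And>n. continuous_on ({0..T} \<times> \<Omega>) (\<psi> n)"
    "\<And>n p. p \<in> {0..T} \<times> \<Omega> \<Longrightarrow> v p - \<psi> n p \<le> \<kappa>" "\<And>n y. \<psi> n (t, y) = \<Phi> (t, y)"
    "\<And>n s. s \<in> {0..<t} \<Longrightarrow> \<psi> n (s, x) \<le> \<Phi> (s, x) + (t - s)"
    "\<And>s. s \<in> {0..<t} \<Longrightarrow> (\<lambda>n. \<psi> n (s, x)) \<longlonglongrightarrow> v (s, x) - \<kappa>"
proof -
  let ?D = "{0..T} \<times> \<Omega>"
  define z where "z = (\<lambda>p. v p - (\<Phi> p + \<kappa>))"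
  have z: "usc_on ?D z"
    unfolding z_def by (intro usc_on_diff_continuous v continuous_intros \<Phi>)
  have neg: "z p \<le> 0" if "p \<in> ?D" for p using le[OF that] by (simp add: z_def)
  have ne: "?D \<noteq> {}" using x a t by auto
  define h where "h = (\<lambda>N s. SUP p\<in>?D. z p - N * (\<bar>s - fst p\<bar> + (norm (snd p - x))\<^sup>2))"
  have h_eq: "h N s = (SUP p\<in>?D. z p - N * (\<bar>s - fst p\<bar> + (norm (snd p - x))\<^sup>2))" for N s
    by (simp add: h_def)
  note h = sup_convolution[OF z neg ne h_eq]
  define N where "N = (\<lambda>n. real (Suc n))"
  have N: "N n > 0" for n by (simp add: N_def)
  have Nlim: "filterlim N at_top sequentially"
    unfolding N_def by (intro filterlim_compose[OF filterlim_real_sequentially] filterlim_Suc)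
  have "\<exists>P P'. (\<forall>s. (P has_real_derivative P' s) (at s)) \<and> continuous_on UNIV P' \<and>
      (\<forall>s\<in>{0..T}. h (N n) s \<le> P s \<and> P s \<le> h (N n) s + 1 / N n)" for n
  proof -
    have "continuous_on {0..T} (h (N n))"
      using continuous_on_subset[OF h(3)] N[of n] by simp
    \<comment> \<open>The target is raised by half of 1/N and approximated to within that half,
      which places the polynomial between h and h + 1/N.\<close>
    then have "continuous_on {0..T} (\<lambda>s. h (N n) s + 1 / (2 * N n))"
      by (intro continuous_intros) (use N[of n] in auto)
    from Stone_Weierstrass_real_polynomial_function[OF _ this, of "1 / (2 * N n)"] N[of n]
    obtain P where P: "real_polynomial_function P"
      "\<And>s. s \<in> {0..T} \<Longrightarrow> \<bar>h (N n) s + 1 / (2 * N n) - P s\<bar> < 1 / (2 * N n)"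
      by (metis compact_Icc zero_less_divide_1_iff zero_less_mult_iff zero_less_numeral)
    obtain P' where P': "real_polynomial_function P'" "\<And>s. (P has_real_derivative P' s) (at s)"
      using has_real_derivative_polynomial_function[OF P(1)] by blast
    have "continuous_on UNIV P'"
      using P'(1) by (simp add: continuous_on_polymonial_function real_polynomial_function_eq)
    moreover have "h (N n) s \<le> P s \<and> P s \<le> h (N n) s + 1 / N n" if "s \<in> {0..T}" for s
    proof -
      have "1 / N n = 1 / (2 * N n) + 1 / (2 * N n)" using N[of n] by (simp add: field_simps)
      then show ?thesis using P(2)[OF that] by linarith
    qed
    ultimately show ?thesis using P'(2) by blast
  qed
  then obtain P P' where P: "\<And>n s. (P n has_real_derivative P' n s) (at s)" "\<And>n. continuous_on UNIV (P' n)"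
    "\<And>n s. s \<in> {0..T} \<Longrightarrow> h (N n) s \<le> P n s" "\<And>n s. s \<in> {0..T} \<Longrightarrow> P n s \<le> h (N n) s + 1 / N n"
    by metis
  have "\<exists>\<eta> \<eta>'. (\<forall>s. (\<eta> has_real_derivative \<eta>' s) (at s)) \<and> continuous_on UNIV \<eta>' \<and>
      (\<forall>s. 0 \<le> \<eta> s \<and> \<eta> s \<le> 1) \<and> (\<forall>s\<le>t - 2 / N n. \<eta> s = 1) \<and> (\<forall>s\<ge>t - 1 / N n. \<eta> s = 0)" for n
  proof -
    have "t - 2 / N n < t - 1 / N n" using N[of n] by (simp add: divide_simps)
    then obtain c c' where c: "\<And>t. (c has_real_derivative c' t) (at t)" "continuous_on UNIV c'"
      "\<And>t. 0 \<le> c t" "\<And>t. c t \<le> 1" "\<And>s. s \<le> t - 2 / N n \<Longrightarrow> c s = 0" "\<And>s. t - 1 / N n \<le> s \<Longrightarrow> c s = 1"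
      using smooth_step by blast
    have "((\<lambda>s. 1 - c s) has_real_derivative - c' s) (at s)" for s
      by (auto intro!: derivative_eq_intros c(1))
    moreover have "continuous_on UNIV (\<lambda>s. - c' s)" by (intro continuous_intros c(2))
    ultimately show ?thesis
      using c(3-6) by (intro exI[of _ "\<lambda>s. 1 - c s"] exI[of _ "\<lambda>s. - c' s"]) auto
  qed
  then obtain \<eta> \<eta>' where \<eta>: "\<And>n s. (\<eta> n has_real_derivative \<eta>' n s) (at s)" "\<And>n. continuous_on UNIV (\<eta>' n)"
    "\<And>n s. 0 \<le> \<eta> n s" "\<And>n s. \<eta> n s \<le> 1" "\<And>n s. s \<le> t - 2 / N n \<Longrightarrow> \<eta> n s = 1" "\<And>n s. t - 1 / N n \<le> s \<Longrightarrow> \<eta> n s = 0"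
    by metis
  have cont: "continuous_on UNIV (P n)" "continuous_on UNIV (\<eta> n)" for n
    using P(1) \<eta>(1) by (meson DERIV_continuous_on has_field_derivative_at_within)+
  define w where "w = (\<lambda>n p. P n (fst p) + N n * (norm (snd p - x))\<^sup>2)"
  define \<psi> where "\<psi> = (\<lambda>n p. \<Phi> p + \<eta> n (fst p) * w n p)"
  obtain S d g H where S: "open S" "{a<..T} \<times> \<Omega> \<subseteq> S" "S \<subseteq> UNIV \<times> \<Omega>" "C12_witness S \<Phi> d g H"
    using iffD1[OF C12_iff_witness[OF \<Omega> a(2)] \<Phi>(1)] by blast
  \<comment> \<open>The polynomial in time will enter as a time factor times the constant function
    1.\<close>
  have one: "C2_witness UNIV (\<lambda>x::real^'d. 1) (\<lambda>x. 0) (\<lambda>x. 0)"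
    by (auto simp: C2_witness_def)
  show ?thesis
  proof (rule that)
    show "C12 a T \<Omega> (\<psi> n)" for n
    proof -
      note W1 = C12_witness_time_mult[OF C12_witness_of_C2[OF one, of S] P(1,2)[of n], simplified]
      note W2 = C12_witness_time_mult[OF C12_witness_of_C2[OF C2_witness_norm_sq[of UNIV x], of S], where c = "\<lambda>s. N n" and c' = "\<lambda>s. 0", simplified]
      show ?thesis
        unfolding C12_iff_witness[OF \<Omega> a(2)] \<psi>_def w_def
        using S(1-3) C12_witness_add[OF S(4) C12_witness_time_mult[OF C12_witness_add[OF W1 W2] \<eta>(1,2)[of n]]]
        by blast
    qed
    show "continuous_on ?D (\<psi> n)" for n
      unfolding \<psi>_def w_def
      by (intro continuous_intros \<Phi>(2) continuous_on_compose2[OF cont(1)] continuous_on_compose2[OF cont(2)]) auto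
    show "v p - \<psi> n p \<le> \<kappa>" if p: "p \<in> ?D" for p n
    proof -
      have "z p \<le> w n p"
        using h(1)[of "N n" p] P(3)[of "fst p" n] N[of n] p by (force simp: w_def)
      then have "\<eta> n (fst p) * z p \<le> \<eta> n (fst p) * w n p"
        by (intro mult_left_mono \<eta>(3))
      \<comment> \<open>z is split with weights \<eta> and 1 - \<eta>: the first share is absorbed
        by the correction, the second is nonpositive.\<close>
      moreover have "(1 - \<eta> n (fst p)) * z p \<le> 0"
        using neg[OF p] \<eta>(4)[of n "fst p"] by (intro mult_nonneg_nonpos) auto
      ultimately have "z p \<le> \<eta> n (fst p) * w n p" by (simp add: algebra_simps)
      then show ?thesis by (simp add: z_def \<psi>_def)
    qed
    show "\<psi> n (t, y) = \<Phi> (t, y)" for n y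
      using \<eta>(6)[of n t] N[of n] by (simp add: \<psi>_def)
    show "\<psi> n (s, x) \<le> \<Phi> (s, x) + (t - s)" if s: "s \<in> {0..<t}" for n s
    proof (cases "t - 1 / N n \<le> s")
      case True
      then show ?thesis using \<eta>(6)[OF True] s by (simp add: \<psi>_def)
    next
      case False
      \<comment> \<open>Since h is nonpositive, the polynomial is at most 1/N, and outside the zone
        where the cutoff vanishes 1/N is less than t - s.\<close>
      have "P n s \<le> 1 / N n"
        using P(4)[of s n] h(2)[of "N n" s] N[of n] s t by fastforce
      then have "\<eta> n s * P n s \<le> 1 * (1 / N n)"
        using \<eta>(3,4)[of n s] N[of n] by (meson less_imp_le mult_left_mono mult_right_mono order_trans zero_le_divide_1_iff)
      then show ?thesis using False by (simp add: \<psi>_def w_def)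
    qed
    show "(\<lambda>n. \<psi> n (s, x)) \<longlonglongrightarrow> v (s, x) - \<kappa>" if s: "s \<in> {0..<t}" for s
    proof -
      have sD: "(s, x) \<in> ?D" "s \<in> {0..T}" using s t x by auto
      have hl: "(\<lambda>n. h (N n) s) \<longlonglongrightarrow> z (s, x)"
        by (rule filterlim_compose[OF h(4) Nlim]) (use sD in auto)
      have N0: "(\<lambda>n. c / N n) \<longlonglongrightarrow> 0" for c
        by (rule real_tendsto_divide_at_top[OF tendsto_const Nlim])
      have "(\<lambda>n. h (N n) s + 1 / N n) \<longlonglongrightarrow> z (s, x) + 0"
        by (intro tendsto_add hl N0)
      then have upper: "(\<lambda>n. h (N n) s + 1 / N n) \<longlonglongrightarrow> z (s, x)" by simp
      have "(\<lambda>n. P n s) \<longlonglongrightarrow> z (s, x)"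
        by (rule tendsto_sandwich[OF _ _ hl upper]) (simp_all add: P(3,4)[OF sD(2)])
      then have "(\<lambda>n. \<Phi> (s, x) + P n s) \<longlonglongrightarrow> \<Phi> (s, x) + z (s, x)"
        by (intro tendsto_intros)
      \<comment> \<open>For fixed s < t the cutoff equals 1 at s from some n on, so only the
        polynomial remains to be followed.\<close>
      moreover have "\<forall>\<^sub>F n in sequentially. 2 / N n < t - s"
        using order_tendstoD(2)[OF N0] s by simp
      then have "\<forall>\<^sub>F n in sequentially. \<Phi> (s, x) + P n s = \<psi> n (s, x)"
      proof eventually_elim
        case (elim n)
        then show ?case using \<eta>(5)[of s n] by (simp add: \<psi>_def w_def)
      qed
      ultimately have "(\<lambda>n. \<psi> n (s, x)) \<longlonglongrightarrow> \<Phi> (s, x) + z (s, x)"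
        by (rule Lim_transform_eventually)
      then show ?thesis by (simp add: z_def)
    qed
  qed
qed

text \<open>The constant \<open>C\<close> is arbitrary, so the lemma serves for a finite nonlinear
  term and also, with an absurd bound, when that term is infinite.\<close>

lemma subsolution_test_limit:
  fixes v :: "real \<times> (real ^ 'd) \<Rightarrow> real"
  assumes \<alpha>: "0 < \<alpha>" "\<alpha> < 1" and a: "0 \<le> a" "a < T" and \<Omega>: "open \<Omega>"
    and v: "usc_on ({0..T} \<times> \<Omega>) v" and t: "t \<in> {a<..T}" and x: "x \<in> \<Omega>"
    and \<phi>: "C12 a T \<Omega> \<phi>" and mx: "max_on_at ({a<..T} \<times> \<Omega>) (\<lambda>p. v p - \<phi> p) (t, x)"
    and test: "\<And>\<psi>. C12 a T \<Omega> \<psi> \<Longrightarrow> continuous_on ({0..T} \<times> \<Omega>) \<psi> \<Longrightarrow>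
      max_on_at ({0..T} \<times> \<Omega>) (\<lambda>p. v p - \<psi> p) (t, x) \<Longrightarrow> (\<And>y. \<psi> (t, y) = \<phi> (t, y)) \<Longrightarrow>
      J \<alpha> (\<lambda>s. \<psi> (s, x)) t + K0 \<alpha> (\<lambda>s. \<psi> (s, x)) t \<le> C"
  shows "K0_exists \<alpha> (\<lambda>s. v (s, x)) t"
    and "J \<alpha> (\<lambda>s. v (s, x)) t + K0 \<alpha> (\<lambda>s. v (s, x)) t \<le> C"
proof -
  \<comment> \<open>The contact gap: test functions touch v only up to this constant, which cancels
    in all increments.\<close>
  define \<kappa> where "\<kappa> = v (t, x) - \<phi> (t, x)"
  have le: "v p - \<phi> p \<le> \<kappa>" if "p \<in> {a<..T} \<times> \<Omega>" for p
    using mx that unfolding max_on_at_def \<kappa>_def by blast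
  obtain \<Phi> where \<Phi>: "C12 a T \<Omega> \<Phi>" "continuous_on ({0..T} \<times> \<Omega>) \<Phi>"
    "\<And>p. p \<in> {0..T} \<times> \<Omega> \<Longrightarrow> v p - \<Phi> p \<le> \<kappa>" "\<And>y. \<Phi> (t, y) = \<phi> (t, y)"
    using C12_majorant_extension[OF \<Omega> a t v \<phi> le] by blast
  obtain \<psi> :: "nat \<Rightarrow> real \<times> (real ^ 'd) \<Rightarrow> real" where \<psi>:
    "\<And>n. C12 a T \<Omega> (\<psi> n)" "\<And>n. continuous_on ({0..T} \<times> \<Omega>) (\<psi> n)"
    "\<And>n p. p \<in> {0..T} \<times> \<Omega> \<Longrightarrow> v p - \<psi> n p \<le> \<kappa>" "\<And>n y. \<psi> n (t, y) = \<Phi> (t, y)"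
    "\<And>n s. s \<in> {0..<t} \<Longrightarrow> \<psi> n (s, x) \<le> \<Phi> (s, x) + (t - s)"
    "\<And>s. s \<in> {0..<t} \<Longrightarrow> (\<lambda>n. \<psi> n (s, x)) \<longlonglongrightarrow> v (s, x) - \<kappa>"
    using C12_approximating_majorants[OF \<Omega> a t x v \<Phi>(1-3)] by blast
  have t0: "0 < t" using t a by simp
  have val: "\<psi> n (t, x) = v (t, x) - \<kappa>" "\<Phi> (t, x) = v (t, x) - \<kappa>" for n
    by (simp_all add: \<psi>(4) \<Phi>(4) \<kappa>_def)
  \<comment> \<open>The barrier is \<Phi>(s, x) - s: its increments are those of \<Phi> lowered by t
    - s, which matches the uniform upper bound on the approximating functions.\<close>
  note Fatou = K0_Fatou[of t \<alpha> "\<lambda>n s. \<psi> n (s, x)" "\<lambda>s. \<Phi> (s, x) + (-1) * s" "\<lambda>s. v (s, x)" C]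
  have F1: "set_integrable lebesgue {0<..<t} (K_integrand \<alpha> (\<lambda>s. \<psi> n (s, x)) t)" for n
    using C12_K_integrand_integrable[OF \<Omega> a \<alpha>(2) \<psi>(1,2)[of n] t x, where c = 0] by simp
  have F2: "set_integrable lebesgue {0<..<t} (K_integrand \<alpha> (\<lambda>s. \<Phi> (s, x) + (-1) * s) t)"
    by (rule C12_K_integrand_integrable[OF \<Omega> a \<alpha>(2) \<Phi>(1,2) t x])
  have F3: "\<Phi> (t, x) + (-1) * t - (\<Phi> (s, x) + (-1) * s) \<le> \<psi> n (t, x) - \<psi> n (s, x)" if "s \<in> {0..<t}" for n s
    using \<psi>(5)[OF that, of n] by (simp add: val)
  have F4: "(\<lambda>n. \<psi> n (t, x) - \<psi> n (s, x)) \<longlonglongrightarrow> v (t, x) - v (s, x)" if "s \<in> {0..<t}" for s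
    using tendsto_diff[OF tendsto_const \<psi>(6)[OF that], of "v (t, x) - \<kappa>"] by (simp add: val)
  have F5: "J \<alpha> (\<lambda>s. \<psi> n (s, x)) t + K0 \<alpha> (\<lambda>s. \<psi> n (s, x)) t \<le> C" for n
  proof (rule test[OF \<psi>(1,2)])
    show "max_on_at ({0..T} \<times> \<Omega>) (\<lambda>p. v p - \<psi> n p) (t, x)"
      using \<psi>(3) t x a by (auto simp: max_on_at_def val)
  qed (simp add: \<psi>(4) \<Phi>(4))
  have "set_integrable lebesgue {0<..<t} (K_integrand \<alpha> (\<lambda>s. v (s, x)) t)"
    by (rule Fatou(1)[OF t0 \<alpha> F1 F2 F3 F4 F5])
  then show "K0_exists \<alpha> (\<lambda>s. v (s, x)) t"
    by (rule K0_exists_of_integrable[OF t0])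
  show "J \<alpha> (\<lambda>s. v (s, x)) t + K0 \<alpha> (\<lambda>s. v (s, x)) t \<le> C"
    by (rule Fatou(2)[OF t0 \<alpha> F1 F2 F3 F4 F5])
qed

section \<open>Equivalence of the two definitions\<close>

lemma grad_hess_cong_slice:
  assumes "\<And>y. \<psi> (t, y) = \<phi> (t, y)"
  shows "grad \<psi> (t, x) = grad \<phi> (t, x)" and "hess \<psi> (t, x) = hess \<phi> (t, x)"
  by (simp_all add: grad_def hess_def assms)

text \<open>
  No symmetry of the matrix is required here: away from the closed set of symmetric matrices the
  envelopes are taken over the empty set, so the lower one is \<open>+\<infinity>\<close>. In this way the
  symmetry of the Hessian of a test function is never needed.
\<close>

lemma lsc_env_domW_not_minf:
  fixes F :: "real \<times> (real ^ 'd) \<times> real \<times> (real ^ 'd) \<times> (real ^ 'd ^ 'd) \<Rightarrow> real"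
  assumes F: "\<And>w. w \<in> domW a T \<Omega> \<Longrightarrow> -\<infinity> < lsc_env (domW a T \<Omega>) F w"
    and t: "t \<in> {a<..T}" and x: "x \<in> \<Omega>"
  shows "lsc_env (domW a T \<Omega>) F (t, x, r, p, X) \<noteq> -\<infinity>"
proof (cases "transpose X = X")
  case True
  then show ?thesis
    using F[of "(t, x, r, p, X)"] t x by (auto simp: domW_def)
next
  case False
  have "closed {X :: real ^ 'd ^ 'd. transpose X = X}"
    unfolding transpose_def vec_eq_iff
    by (simp, intro closed_Collect_all closed_Collect_eq continuous_on_component continuous_on_id)
  then have "open (- {X :: real ^ 'd ^ 'd. transpose X = X})" by (simp add: open_Compl)
  then obtain e where e: "e > 0" "cball X e \<subseteq> - {X. transpose X = X}"
    using False unfolding open_contains_cball by blast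
  have "domW a T \<Omega> \<inter> cball (t, x, r, p, X) e = {}"
  proof -
    have cball_X: "Y \<in> cball X e" if "(s, y, r', p', Y) \<in> cball (t, x, r, p, X) e" for s y r' p' Y
      using that dist_snd_le[of "(t, x, r, p, X)" "(s, y, r', p', Y)"] dist_snd_le[of "(x, r, p, X)" "(y, r', p', Y)"]
        dist_snd_le[of "(r, p, X)" "(r', p', Y)"] dist_snd_le[of "(p, X)" "(p', Y)"]
      by simp
    have "w \<notin> domW a T \<Omega>" if "w \<in> cball (t, x, r, p, X) e" for w
    proof (cases w)
      case (fields s y r' p' Y)
      then have "Y \<in> cball X e" using cball_X that by blast
      then have "transpose Y \<noteq> Y" using e(2) by blast
      then show ?thesis by (simp add: domW_def fields)
    qed
    then show ?thesis by blast
  qed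
  then have "usc_env (domW a T \<Omega>) (\<lambda>w. - F w) (t, x, r, p, X) \<le> (SUP y\<in>{}. ereal (- F y))"
    unfolding usc_env_eq_INF using e(1) by (intro INF_lower2[of e]) auto
  then show ?thesis
    by (simp add: lsc_env_def bot_ereal_def)
qed

text \<open>The nonlinear term is abstracted to \<open>N\<close>, of which only two facts enter: it
  depends on the slice at time t, and it is never minus infinity, where the test inequality would
  give no bound on J + K0. This form can be reused for supersolutions after a change of
  sign.\<close>

lemma subsolution_equiv:
  fixes v :: "real \<times> (real ^ 'd) \<Rightarrow> real"
    and N :: "(real \<times> (real ^ 'd) \<Rightarrow> real) \<Rightarrow> ereal"
  assumes \<alpha>: "0 < \<alpha>" "\<alpha> < 1" and a: "0 \<le> a" "a < T" and \<Omega>: "open \<Omega>"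
    and v: "usc_on ({0..T} \<times> \<Omega>) v" and t: "t \<in> {a<..T}" and x: "x \<in> \<Omega>"
    and slice: "\<And>\<phi> \<psi>. (\<And>y. \<psi> (t, y) = \<phi> (t, y)) \<Longrightarrow> N \<psi> = N \<phi>"
    and G: "\<And>\<phi>. N \<phi> \<noteq> -\<infinity>"
  shows "(\<forall>\<phi>. C12 a T \<Omega> \<phi> \<longrightarrow> continuous_on ({0..T} \<times> \<Omega>) \<phi> \<longrightarrow>
        max_on_at ({0..T} \<times> \<Omega>) (\<lambda>p. v p - \<phi> p) (t, x) \<longrightarrow>
        ereal (J \<alpha> (\<lambda>s. \<phi> (s, x)) t + K0 \<alpha> (\<lambda>s. \<phi> (s, x)) t) + N \<phi> \<le> 0)
    \<longleftrightarrow> (\<forall>\<phi>. C12 a T \<Omega> \<phi> \<longrightarrow> max_on_at ({a<..T} \<times> \<Omega>) (\<lambda>p. v p - \<phi> p) (t, x) \<longrightarrow>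
        K0_exists \<alpha> (\<lambda>s. v (s, x)) t \<and>
        ereal (J \<alpha> (\<lambda>s. v (s, x)) t + K0 \<alpha> (\<lambda>s. v (s, x)) t) + N \<phi> \<le> 0)"
    (is "?L \<longleftrightarrow> ?R")
proof
  assume L: ?L
  show ?R
  proof (intro allI impI)
    fix \<phi> assume \<phi>: "C12 a T \<Omega> \<phi>" and mx: "max_on_at ({a<..T} \<times> \<Omega>) (\<lambda>p. v p - \<phi> p) (t, x)"
    let ?G = "N \<phi>"
    let ?S = "\<lambda>f. J \<alpha> (\<lambda>s. f (s, x)) t + K0 \<alpha> (\<lambda>s. f (s, x)) t"
    have test: "ereal (?S \<psi>) + ?G \<le> 0"
      if "C12 a T \<Omega> \<psi>" "continuous_on ({0..T} \<times> \<Omega>) \<psi>" "max_on_at ({0..T} \<times> \<Omega>) (\<lambda>p. v p - \<psi> p) (t, x)"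
        "\<And>y. \<psi> (t, y) = \<phi> (t, y)" for \<psi>
    proof -
      have "N \<psi> = N \<phi>" by (rule slice) (rule that(4))
      then show ?thesis using L[rule_format, OF that(1-3)] by (simp only:)
    qed
    note lim = subsolution_test_limit[OF \<alpha> a \<Omega> v t x \<phi> mx]
    show "K0_exists \<alpha> (\<lambda>s. v (s, x)) t \<and> ereal (?S v) + ?G \<le> 0"
    proof (cases ?G)
      case (real r)
      have bound: "?S \<psi> \<le> - r"
        if "C12 a T \<Omega> \<psi>" "continuous_on ({0..T} \<times> \<Omega>) \<psi>" "max_on_at ({0..T} \<times> \<Omega>) (\<lambda>p. v p - \<psi> p) (t, x)"
          "\<And>y. \<psi> (t, y) = \<phi> (t, y)" for \<psi>
        using test[OF that] unfolding real by simp
      have ex: "K0_exists \<alpha> (\<lambda>s. v (s, x)) t"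
        by (rule lim(1)) (rule bound)
      have "?S v \<le> - r"
        by (rule lim(2)) (rule bound)
      with ex show ?thesis unfolding real by simp
    next
      case PInf
      \<comment> \<open>Then no admissible test function exists, and the limit bound holds for every constant.\<close>
      have bound: "?S \<psi> \<le> ?S v - 1"
        if "C12 a T \<Omega> \<psi>" "continuous_on ({0..T} \<times> \<Omega>) \<psi>" "max_on_at ({0..T} \<times> \<Omega>) (\<lambda>p. v p - \<psi> p) (t, x)"
          "\<And>y. \<psi> (t, y) = \<phi> (t, y)" for \<psi>
        using test[OF that] unfolding PInf by simp
      have "?S v \<le> ?S v - 1"
        by (rule lim(2)) (rule bound)
      then show ?thesis by simp
    next
      case MInf
      then show ?thesis using G by blast
    qed
  qed
next
  assume R: ?R
  show ?L
  proof (intro allI impI)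
    fix \<phi> assume \<phi>: "C12 a T \<Omega> \<phi>" "continuous_on ({0..T} \<times> \<Omega>) \<phi>"
      and mx: "max_on_at ({0..T} \<times> \<Omega>) (\<lambda>p. v p - \<phi> p) (t, x)"
    let ?G = "N \<phi>"
    have "max_on_at ({a<..T} \<times> \<Omega>) (\<lambda>p. v p - \<phi> p) (t, x)"
      using mx t a by (auto simp: max_on_at_def)
    then have ex: "K0_exists \<alpha> (\<lambda>s. v (s, x)) t"
      and le: "ereal (J \<alpha> (\<lambda>s. v (s, x)) t + K0 \<alpha> (\<lambda>s. v (s, x)) t) + ?G \<le> 0"
      using R \<phi>(1) by auto
    have "J \<alpha> (\<lambda>s. \<phi> (s, x)) t + K0 \<alpha> (\<lambda>s. \<phi> (s, x)) t \<le> J \<alpha> (\<lambda>s. v (s, x)) t + K0 \<alpha> (\<lambda>s. v (s, x)) t"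
    proof (rule JK0_mono[OF _ \<alpha> _ ex])
      show "set_integrable lebesgue {0<..<t} (K_integrand \<alpha> (\<lambda>s. \<phi> (s, x)) t)"
        using C12_K_integrand_integrable[OF \<Omega> a \<alpha>(2) \<phi> t x, where c = 0] by simp
      fix s assume "s \<in> {0..t}"
      then have "v (s, x) - \<phi> (s, x) \<le> v (t, x) - \<phi> (t, x)"
        using mx t x by (simp add: max_on_at_def)
      then show "\<phi> (t, x) - \<phi> (s, x) \<le> v (t, x) - v (s, x)" by simp
    qed (use t a in auto)
    then have "ereal (J \<alpha> (\<lambda>s. \<phi> (s, x)) t + K0 \<alpha> (\<lambda>s. \<phi> (s, x)) t) + ?G
        \<le> ereal (J \<alpha> (\<lambda>s. v (s, x)) t + K0 \<alpha> (\<lambda>s. v (s, x)) t) + ?G"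
      by (intro add_right_mono) (simp only: ereal_less_eq)
    then show "ereal (J \<alpha> (\<lambda>s. \<phi> (s, x)) t + K0 \<alpha> (\<lambda>s. \<phi> (s, x)) t) + ?G \<le> 0"
      using le by (rule order_trans)
  qed
qed

text \<open>Reduction to the previous equivalence by replacing \<open>w\<close>, the test functions
  and \<open>N\<close> with their negatives. Negation is a bijection of the test functions that
  turns minima into maxima.\<close>

lemma supersolution_equiv:
  fixes w :: "real \<times> (real ^ 'd) \<Rightarrow> real"
    and N :: "(real \<times> (real ^ 'd) \<Rightarrow> real) \<Rightarrow> ereal"
  assumes \<alpha>: "0 < \<alpha>" "\<alpha> < 1" and a: "0 \<le> a" "a < T" and \<Omega>: "open \<Omega>"
    and w: "usc_on ({0..T} \<times> \<Omega>) (\<lambda>p. - w p)" and t: "t \<in> {a<..T}" and x: "x \<in> \<Omega>"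
    and slice: "\<And>\<phi> \<psi>. (\<And>y. \<psi> (t, y) = \<phi> (t, y)) \<Longrightarrow> N \<psi> = N \<phi>"
    and G: "\<And>\<phi>. N \<phi> \<noteq> \<infinity>"
  shows "(\<forall>\<phi>. C12 a T \<Omega> \<phi> \<longrightarrow> continuous_on ({0..T} \<times> \<Omega>) \<phi> \<longrightarrow>
        min_on_at ({0..T} \<times> \<Omega>) (\<lambda>p. w p - \<phi> p) (t, x) \<longrightarrow>
        ereal (J \<alpha> (\<lambda>s. \<phi> (s, x)) t + K0 \<alpha> (\<lambda>s. \<phi> (s, x)) t) + N \<phi> \<ge> 0)
    \<longleftrightarrow> (\<forall>\<phi>. C12 a T \<Omega> \<phi> \<longrightarrow> min_on_at ({a<..T} \<times> \<Omega>) (\<lambda>p. w p - \<phi> p) (t, x) \<longrightarrow>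
        K0_exists \<alpha> (\<lambda>s. w (s, x)) t \<and>
        ereal (J \<alpha> (\<lambda>s. w (s, x)) t + K0 \<alpha> (\<lambda>s. w (s, x)) t) + N \<phi> \<ge> 0)"
    (is "(\<forall>\<phi>. ?L \<phi>) \<longleftrightarrow> (\<forall>\<phi>. ?R \<phi>)")
proof -
  let ?S = "\<lambda>f. J \<alpha> (\<lambda>s. f (s, x)) t + K0 \<alpha> (\<lambda>s. f (s, x)) t"
  have reflect: "(\<forall>\<phi>. P \<phi>) \<longleftrightarrow> (\<forall>\<phi>. P (\<lambda>p. - \<phi> p))" for P :: "(real \<times> (real ^ 'd) \<Rightarrow> real) \<Rightarrow> bool"
  proof
    assume *: "\<forall>\<phi>. P (\<lambda>p. - \<phi> p)"
    show "\<forall>\<phi>. P \<phi>"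
    proof
      show "P \<phi>" for \<phi> using *[rule_format, of "\<lambda>p. - \<phi> p"] by simp
    qed
  qed simp
  have C12_neg: "C12 a T \<Omega> (\<lambda>p. - \<phi> p) \<longleftrightarrow> C12 a T \<Omega> \<phi>" for \<phi>
    using C12_uminus[OF \<Omega> a(2), of \<phi>] C12_uminus[OF \<Omega> a(2), of "\<lambda>p. - \<phi> p"] by auto
  have cont_neg: "continuous_on A (\<lambda>p. - \<phi> p) \<longleftrightarrow> continuous_on A \<phi>"
    for A :: "(real \<times> (real ^ 'd)) set" and \<phi> :: "real \<times> (real ^ 'd) \<Rightarrow> real"
    using continuous_on_minus[of A \<phi>] continuous_on_minus[of A "\<lambda>p. - \<phi> p"] by auto
  have mx: "min_on_at A (\<lambda>p. w p - - \<phi> p) (t, x) \<longleftrightarrow> max_on_at A (\<lambda>p. - w p - \<phi> p) (t, x)" for A \<phi>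
  proof -
    have "(- w q - \<phi> q \<le> - w p - \<phi> p) = (w p - - \<phi> p \<le> w q - - \<phi> q)" for p q by linarith
    then show ?thesis by (simp add: min_on_at_def max_on_at_def)
  qed
  have S_neg: "?S (\<lambda>p. - f p) = - ?S f" if "K0_exists \<alpha> (\<lambda>s. f (s, x)) t" for f
    using K0_uminus[OF _ that] t a by (simp add: J_uminus)
  have ereal_neg: "0 \<le> ereal r + g \<longleftrightarrow> ereal (- r) + - g \<le> 0" if "g \<noteq> \<infinity>" for r g
    using that by (cases g) (auto simp:)
  have "?L (\<lambda>p. - \<phi> p) \<longleftrightarrow> (C12 a T \<Omega> \<phi> \<longrightarrow> continuous_on ({0..T} \<times> \<Omega>) \<phi> \<longrightarrow>
        max_on_at ({0..T} \<times> \<Omega>) (\<lambda>p. - w p - \<phi> p) (t, x) \<longrightarrow>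
        ereal (?S \<phi>) + - N (\<lambda>p. - \<phi> p) \<le> 0)" for \<phi>
  proof -
    \<comment> \<open>Pulling the sign out of K0 needs existence of the limit; for test functions it
      comes from their regularity at t.\<close>
    have "- ?S (\<lambda>p. - \<phi> p) = ?S \<phi>" if "C12 a T \<Omega> \<phi>" "continuous_on ({0..T} \<times> \<Omega>) \<phi>"
    proof -
      have "set_integrable lebesgue {0<..<t} (K_integrand \<alpha> (\<lambda>s. \<phi> (s, x)) t)"
        using C12_K_integrand_integrable[OF \<Omega> a \<alpha>(2) that t x, where c = 0] by simp
      then have "K0_exists \<alpha> (\<lambda>s. \<phi> (s, x)) t"
        using t a by (intro K0_exists_of_integrable) auto
      from S_neg[OF this] show ?thesis by linarith
    qed
    then show ?thesis
      unfolding C12_neg cont_neg mx ereal_neg[OF G] by (simp only: cong: imp_cong)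
  qed
  moreover have "?R (\<lambda>p. - \<phi> p) \<longleftrightarrow> (C12 a T \<Omega> \<phi> \<longrightarrow>
        max_on_at ({a<..T} \<times> \<Omega>) (\<lambda>p. - w p - \<phi> p) (t, x) \<longrightarrow>
        K0_exists \<alpha> (\<lambda>s. - w (s, x)) t \<and> ereal (?S (\<lambda>p. - w p)) + - N (\<lambda>p. - \<phi> p) \<le> 0)" for \<phi>
    \<comment> \<open>For \<open>w\<close> the existence of K0 is the first conjunct on both sides,
      which justifies the change of sign in the second.\<close>
    unfolding C12_neg mx K0_exists_uminus using S_neg[of w] by (auto simp: ereal_neg[OF G])
  moreover have "(\<forall>\<phi>. C12 a T \<Omega> \<phi> \<longrightarrow> continuous_on ({0..T} \<times> \<Omega>) \<phi> \<longrightarrow>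
        max_on_at ({0..T} \<times> \<Omega>) (\<lambda>p. - w p - \<phi> p) (t, x) \<longrightarrow>
        ereal (?S \<phi>) + - N (\<lambda>p. - \<phi> p) \<le> 0)
     \<longleftrightarrow> (\<forall>\<phi>. C12 a T \<Omega> \<phi> \<longrightarrow> max_on_at ({a<..T} \<times> \<Omega>) (\<lambda>p. - w p - \<phi> p) (t, x) \<longrightarrow>
        K0_exists \<alpha> (\<lambda>s. - w (s, x)) t \<and> ereal (?S (\<lambda>p. - w p)) + - N (\<lambda>p. - \<phi> p) \<le> 0)"
  proof (rule subsolution_equiv[OF \<alpha> a \<Omega> w t x, where N = "\<lambda>\<phi>. - N (\<lambda>p. - \<phi> p)"])
    show "- N (\<lambda>p. - \<psi> p) = - N (\<lambda>p. - \<phi> p)" if "\<And>y. \<psi> (t, y) = \<phi> (t, y)" for \<phi> \<psi>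
      using slice[of "\<lambda>p. - \<psi> p" "\<lambda>p. - \<phi> p"] that by simp
    show "- N (\<lambda>p. - \<phi> p) \<noteq> -\<infinity>" for \<phi> using G by simp
  qed
  ultimately have "(\<forall>\<phi>. ?L (\<lambda>p. - \<phi> p)) \<longleftrightarrow> (\<forall>\<phi>. ?R (\<lambda>p. - \<phi> p))"
    by presburger
  then show ?thesis
    unfolding reflect[of ?L] reflect[of ?R] .
qed

theorem proposition2p5:
  fixes \<alpha> a T :: real
    and \<Omega> :: "(real ^ 'd) set"
    and F :: "real \<times> (real ^ 'd) \<times> real \<times> (real ^ 'd) \<times> (real ^ 'd ^ 'd) \<Rightarrow> real"
    and u :: "real \<times> (real ^ 'd) \<Rightarrow> real"
  assumes "T > 0" and "0 < \<alpha>" and "\<alpha> < 1" and "0 \<le> a" and "a < T" and "open \<Omega>"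
    and "\<And>w. w \<in> domW a T \<Omega> \<Longrightarrow>
           -\<infinity> < lsc_env (domW a T \<Omega>) F w \<and>
           lsc_env (domW a T \<Omega>) F w \<le> usc_env (domW a T \<Omega>) F w \<and>
           usc_env (domW a T \<Omega>) F w < \<infinity>"
  shows
    "(viscosity_subsolution \<alpha> a T \<Omega> F u \<longleftrightarrow>
       (\<forall>p\<in>{0..T} \<times> \<Omega>. usc_env ({0..T} \<times> \<Omega>) u p < \<infinity>) \<and>
       (\<forall>t x \<phi>. t \<in> {a<..T} \<longrightarrow> x \<in> \<Omega> \<longrightarrow> C12 a T \<Omega> \<phi> \<longrightarrow>
          max_on_at ({a<..T} \<times> \<Omega>) (\<lambda>p. upper T \<Omega> u p - \<phi> p) (t, x) \<longrightarrow>
          K0_exists \<alpha> (\<lambda>s. upper T \<Omega> u (s, x)) t \<and>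
          ereal (J \<alpha> (\<lambda>s. upper T \<Omega> u (s, x)) t + K0 \<alpha> (\<lambda>s. upper T \<Omega> u (s, x)) t)
            + lsc_env (domW a T \<Omega>) F
                (t, x, upper T \<Omega> u (t, x), grad \<phi> (t, x), hess \<phi> (t, x)) \<le> 0))
     \<and>
     (viscosity_supersolution \<alpha> a T \<Omega> F u \<longleftrightarrow>
       (\<forall>p\<in>{0..T} \<times> \<Omega>. lsc_env ({0..T} \<times> \<Omega>) u p > -\<infinity>) \<and>
       (\<forall>t x \<phi>. t \<in> {a<..T} \<longrightarrow> x \<in> \<Omega> \<longrightarrow> C12 a T \<Omega> \<phi> \<longrightarrow>
          min_on_at ({a<..T} \<times> \<Omega>) (\<lambda>p. lower T \<Omega> u p - \<phi> p) (t, x) \<longrightarrow>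
          K0_exists \<alpha> (\<lambda>s. lower T \<Omega> u (s, x)) t \<and>
          ereal (J \<alpha> (\<lambda>s. lower T \<Omega> u (s, x)) t + K0 \<alpha> (\<lambda>s. lower T \<Omega> u (s, x)) t)
            + usc_env (domW a T \<Omega>) F
                (t, x, lower T \<Omega> u (t, x), grad \<phi> (t, x), hess \<phi> (t, x)) \<ge> 0))"
proof -
  let ?D = "{0..T} \<times> \<Omega>" and ?W = "domW a T \<Omega>"
  note par = \<open>0 < \<alpha>\<close> \<open>\<alpha> < 1\<close> \<open>0 \<le> a\<close> \<open>a < T\<close> \<open>open \<Omega>\<close>
  have low: "lsc_env ?W F (t, x, r, p, X) \<noteq> -\<infinity>" if "t \<in> {a<..T}" "x \<in> \<Omega>" for t x r p X
    using lsc_env_domW_not_minf[of a T \<Omega> F t x r p X] assms(7) that by blast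
  \<comment> \<open>The upper envelope of F is minus the lower envelope of -F, so the previous bound
    is applied to -F.\<close>
  have up: "usc_env ?W F (t, x, r, p, X) \<noteq> \<infinity>" if "t \<in> {a<..T}" "x \<in> \<Omega>" for t x r p X
    using lsc_env_domW_not_minf[of a T \<Omega> "\<lambda>w. - F w" t x r p X] assms(7) that
    by (auto simp: lsc_env_def ereal_uminus_less_reorder)
  have lower_eq: "lower T \<Omega> u = (\<lambda>p. - upper T \<Omega> (\<lambda>q. - u q) p)"
    by (simp add: fun_eq_iff lower_def upper_def lsc_env_def)
  have usc_upper: "usc_on ?D (upper T \<Omega> u)" if "\<forall>p\<in>?D. usc_env ?D u p < \<infinity>" for u
  proof -
    have "upper T \<Omega> u = (\<lambda>p. real_of_ereal (usc_env ?D u p))"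
      by (simp add: fun_eq_iff upper_def)
    then show ?thesis using usc_on_usc_env[of ?D u] that by metis
  qed
  have usc_lower: "usc_on ?D (\<lambda>p. - lower T \<Omega> u p)" if "\<forall>p\<in>?D. lsc_env ?D u p > -\<infinity>"
    using usc_upper[of "\<lambda>q. - u q"] that by (simp add: lower_eq lsc_env_def ereal_uminus_less_reorder)
  have restrict: "(\<forall>t x \<phi>. t \<in> {a<..T} \<longrightarrow> x \<in> \<Omega> \<longrightarrow> P t x \<phi>) \<longleftrightarrow> (\<forall>t x \<phi>. t \<in> {a<..T} \<longrightarrow> x \<in> \<Omega> \<longrightarrow> Q t x \<phi>)"
    if "\<And>t x. t \<in> {a<..T} \<Longrightarrow> x \<in> \<Omega> \<Longrightarrow> (\<forall>\<phi>. P t x \<phi>) \<longleftrightarrow> (\<forall>\<phi>. Q t x \<phi>)"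
    for P Q :: "real \<Rightarrow> real ^ 'd \<Rightarrow> (real \<times> (real ^ 'd) \<Rightarrow> real) \<Rightarrow> bool"
    using that by blast
  show ?thesis
    unfolding viscosity_subsolution_def viscosity_supersolution_def
  \<comment> \<open>Both sides share the finiteness of the envelope as first conjunct;
    \<open>conj_cong\<close> makes it available when the test conditions are compared at each
    point.\<close>
  proof (rule conjI; rule conj_cong[OF refl]; rule restrict)
    fix t x assume fin: "\<forall>p\<in>?D. usc_env ?D u p < \<infinity>" and tx: "t \<in> {a<..T}" "x \<in> \<Omega>"
    show "(\<forall>\<phi>. C12 a T \<Omega> \<phi> \<longrightarrow> continuous_on ?D \<phi> \<longrightarrow>
          max_on_at ?D (\<lambda>p. upper T \<Omega> u p - \<phi> p) (t, x) \<longrightarrow>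
          ereal (J \<alpha> (\<lambda>s. \<phi> (s, x)) t + K0 \<alpha> (\<lambda>s. \<phi> (s, x)) t)
            + lsc_env ?W F (t, x, upper T \<Omega> u (t, x), grad \<phi> (t, x), hess \<phi> (t, x)) \<le> 0)
      \<longleftrightarrow> (\<forall>\<phi>. C12 a T \<Omega> \<phi> \<longrightarrow> max_on_at ({a<..T} \<times> \<Omega>) (\<lambda>p. upper T \<Omega> u p - \<phi> p) (t, x) \<longrightarrow>
          K0_exists \<alpha> (\<lambda>s. upper T \<Omega> u (s, x)) t \<and>
          ereal (J \<alpha> (\<lambda>s. upper T \<Omega> u (s, x)) t + K0 \<alpha> (\<lambda>s. upper T \<Omega> u (s, x)) t)
            + lsc_env ?W F (t, x, upper T \<Omega> u (t, x), grad \<phi> (t, x), hess \<phi> (t, x)) \<le> 0)"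
    proof (rule subsolution_equiv[OF par usc_upper[OF fin] tx])
      fix \<phi> \<psi> :: "real \<times> (real ^ 'd) \<Rightarrow> real" assume eq: "\<And>y. \<psi> (t, y) = \<phi> (t, y)"
      show "lsc_env ?W F (t, x, upper T \<Omega> u (t, x), grad \<psi> (t, x), hess \<psi> (t, x))
          = lsc_env ?W F (t, x, upper T \<Omega> u (t, x), grad \<phi> (t, x), hess \<phi> (t, x))"
        by (simp only: grad_hess_cong_slice[where \<psi> = \<psi> and \<phi> = \<phi> and t = t, OF eq])
    qed (rule low[OF tx])
  next
    fix t x assume fin: "\<forall>p\<in>?D. lsc_env ?D u p > -\<infinity>" and tx: "t \<in> {a<..T}" "x \<in> \<Omega>"
    show "(\<forall>\<phi>. C12 a T \<Omega> \<phi> \<longrightarrow> continuous_on ?D \<phi> \<longrightarrow>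
          min_on_at ?D (\<lambda>p. lower T \<Omega> u p - \<phi> p) (t, x) \<longrightarrow>
          ereal (J \<alpha> (\<lambda>s. \<phi> (s, x)) t + K0 \<alpha> (\<lambda>s. \<phi> (s, x)) t)
            + usc_env ?W F (t, x, lower T \<Omega> u (t, x), grad \<phi> (t, x), hess \<phi> (t, x)) \<ge> 0)
      \<longleftrightarrow> (\<forall>\<phi>. C12 a T \<Omega> \<phi> \<longrightarrow> min_on_at ({a<..T} \<times> \<Omega>) (\<lambda>p. lower T \<Omega> u p - \<phi> p) (t, x) \<longrightarrow>
          K0_exists \<alpha> (\<lambda>s. lower T \<Omega> u (s, x)) t \<and>
          ereal (J \<alpha> (\<lambda>s. lower T \<Omega> u (s, x)) t + K0 \<alpha> (\<lambda>s. lower T \<Omega> u (s, x)) t)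
            + usc_env ?W F (t, x, lower T \<Omega> u (t, x), grad \<phi> (t, x), hess \<phi> (t, x)) \<ge> 0)"
    proof (rule supersolution_equiv[OF par usc_lower[OF fin] tx])
      fix \<phi> \<psi> :: "real \<times> (real ^ 'd) \<Rightarrow> real" assume eq: "\<And>y. \<psi> (t, y) = \<phi> (t, y)"
      show "usc_env ?W F (t, x, lower T \<Omega> u (t, x), grad \<psi> (t, x), hess \<psi> (t, x))
          = usc_env ?W F (t, x, lower T \<Omega> u (t, x), grad \<phi> (t, x), hess \<phi> (t, x))"
        by (simp only: grad_hess_cong_slice[where \<psi> = \<psi> and \<phi> = \<phi> and t = t, OF eq])
    qed (rule up[OF tx])
  qed
qed

end
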